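(* There exist absolute constants $c, C > 0$ such that the following holds. Let $1 < k \le d$ be integers and $\alpha \in (0,1/2)$. If $\Pi$ is an $(\varepsilon,\delta,1/3)$-robustly shuffle private protocol that releases width-$k$ parities with error $\alpha$ with $n$ users, and $\delta\log\big(\binom{d}{\le k}/\delta\big) \le c\,\alpha^2\varepsilon^2/\binom{d}{\le k}$, then $n \ge C\sqrt{\binom{d}{\le k}}/(\alpha\varepsilon)$.
   Context: Notation: $\binom{d}{\le k} = \sum_{j=1}^{k}\binom{d}{j}$, $[d]=\{1,\dots,d\}$. A procedure releases width-$k$ parities with error $\alpha$ from $n$ samples if, given $n$ i.i.d. samples from any distribution $\mathbf{P}$ over $\{\pm1\}^d$, it outputs $F : 2^{[d]}\to\mathbb{R}$ such that with probability at least $99/100$, for all $\ell\subseteq[d]$ with $|\ell|\le k$, $|F(\ell) - \mathbb{E}_{x\sim\mathbf{P}}[\prod_{j\in\ell}x_j]| \le \alpha$. Shuffle model: a protocol $\Pi = (\Pi_R,\Pi_A)$ has a randomizer $\Pi_R : \mathcal{X}\to\mathcal{Y}^*$ (each user sends a possibly variable-length vector of messages) and an analyzer $\Pi_A : \mathcal{Y}^*\to\mathcal{O}$; the shuffler $\Pi_S$ applies a uniformly random permutation to all messages. On $\vec x\in\mathcal{X}^n$, $\Pi(\vec x) = \Pi_A(\Pi_S(\Pi_R(x_1),\dots,\Pi_R(x_n)))$, and $(\Pi_S\circ\Pi_R^m)(x_1,\dots,x_m) = \Pi_S(\Pi_R(x_1),\dots,\Pi_R(x_m))$. Users and analyzer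 know $n$ and may use public randomness. $A:\mathcal{X}^m\to\mathcal{R}$ is $(\varepsilon,\delta)$-differentially private if for all datasets differing in at most one row and all events $E$, $\Pr[A(\vec x)\in E]\le e^{\varepsilon}\Pr[A(\vec x')\in E]+\delta$. For $\gamma\in(0,1]$, $\Pi$ is $(\varepsilon,\delta,\gamma)$-robustly shuffle differentially private if for all $n$ and all $\gamma'\ge\gamma$, $\Pi_S\circ\Pi_R^{\gamma' n}$ is $(\varepsilon,\delta)$-differentially private. The protocol solves the problem if $\Pi(\vec x)$ meets the accuracy requirement on $n$ i.i.d. samples.
   Formalization: ε is bounded: for each bound on ε there are constants c, C depending only on that bound (for unbounded ε the claim is false); δ lies in [0,1]; messages and public randomness take values in subsets of the reals with arbitrary sigma-algebras. *)

theory Defs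
  imports "HOL-Probability.Probability" "HOL-Combinatorics.Permutations"
begin

definition binom_le :: "nat \<Rightarrow> nat \<Rightarrow> nat" where
  "binom_le d k = (\<Sum>j=1..k. d choose j)"

definition sign_cube :: "nat \<Rightarrow> (nat \<Rightarrow> real) set" where
  "sign_cube d = {1..d} \<rightarrow>\<^sub>E {-1, 1}"

definition query_space :: "nat \<Rightarrow> (nat set \<Rightarrow> real) measure" where
  "query_space d = PiM (Pow {1..d}) (\<lambda>_. borel)"

definition parity_mean :: "(nat \<Rightarrow> real) pmf \<Rightarrow> nat set \<Rightarrow> real" where
  "parity_mean P l = measure_pmf.expectation P (\<lambda>x. \<Prod>j\<in>l. x j)"

definition accurate :: "nat \<Rightarrow> nat \<Rightarrow> real \<Rightarrow> (nat \<Rightarrow> real) pmf \<Rightarrow> (nat set \<Rightarrow> real) \<Rightarrow> bool" where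
  "accurate d k \<alpha> P F \<longleftrightarrow> (\<forall>l. l \<subseteq> {1..d} \<and> card l \<le> k \<longrightarrow> \<bar>F l - parity_mean P l\<bar> \<le> \<alpha>)"

text \<open>
  A randomized procedure on datasets is a function \<open>A\<close> from lists of rows to probability measures.
  The success probability is over both the sample and the coins of \<open>A\<close>. It is written as the
  expectation over the sample of the conditional success probability, so that the values of \<open>A\<close>
  on lists with rows outside the cube, which are unconstrained, are irrelevant.
\<close>

definition releases_parities ::
  "nat \<Rightarrow> nat \<Rightarrow> real \<Rightarrow> nat \<Rightarrow> ((nat \<Rightarrow> real) list \<Rightarrow> (nat set \<Rightarrow> real) measure) \<Rightarrow> bool" where
  "releases_parities d k \<alpha> n A \<longleftrightarrow>
     (\<forall>P. set_pmf P \<subseteq> sign_cube d \<longrightarrow>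
        measure_pmf.expectation (replicate_pmf n P)
          (\<lambda>xs. measure (A xs) {F \<in> space (query_space d). accurate d k \<alpha> P F}) \<ge> 99 / 100)"

definition differentially_private ::
  "'x set \<Rightarrow> nat \<Rightarrow> 'r measure \<Rightarrow> real \<Rightarrow> real \<Rightarrow> ('x list \<Rightarrow> 'r measure) \<Rightarrow> bool" where
  "differentially_private X m R \<epsilon> \<delta> A \<longleftrightarrow>
     (\<forall>xs \<in> lists X. \<forall>ys \<in> lists X.
        length xs = m \<and> length ys = m \<and> card {i. i < m \<and> xs ! i \<noteq> ys ! i} \<le> 1 \<longrightarrow>
        (\<forall>E \<in> sets R. measure (A xs) E \<le> exp \<epsilon> * measure (A ys) E + \<delta>))"

text \<open>
  Finite sequences of messages, as the disjoint union over all lengths of the finite product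
  spaces: \<open>listset [A\<^sub>1, \<dots>, A\<^sub>l]\<close> is the box \<open>A\<^sub>1 \<times> \<dots> \<times> A\<^sub>l\<close>.
\<close>

definition list_space :: "'y measure \<Rightarrow> 'y list measure" where
  "list_space Y = sigma (lists (space Y)) (listset ` lists (sets Y))"

definition shuffler :: "'y measure \<Rightarrow> 'y list \<Rightarrow> 'y list measure" where
  "shuffler Y ms =
     distr (measure_pmf (pmf_of_set {\<sigma>. \<sigma> permutes {..<length ms}})) (list_space Y)
       (\<lambda>\<sigma>. permute_list \<sigma> ms)"

text \<open>
  The concatenated messages of users that apply a local randomizer \<open>R\<close> independently to their rows.
\<close>

primrec reports :: "'y measure \<Rightarrow> ('x \<Rightarrow> 'y list measure) \<Rightarrow> 'x list \<Rightarrow> 'y list measure" where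
  "reports Y R [] = return (list_space Y) []"
| "reports Y R (x # xs) =
     do {us \<leftarrow> R x; vs \<leftarrow> reports Y R xs; return (list_space Y) (us @ vs)}"

definition shuffled_reports ::
  "'y measure \<Rightarrow> ('x \<Rightarrow> 'y list measure) \<Rightarrow> 'x list \<Rightarrow> 'y list measure" where
  "shuffled_reports Y R xs = reports Y R xs \<bind> shuffler Y"

text \<open>
  Users and analyzer know the number \<open>n\<close> of users the protocol is designed for and share a
  public random string, so all components take \<open>n\<close>, and randomizer and analyzer also take that
  string. The randomizer and the analyzer may use private coins. To obtain constants that do not
  depend on the protocol one instantiates \<open>'w\<close> and \<open>'y\<close> with a fixed type, such as \<open>real\<close>:
  a \<open>real measure\<close> may have any subset of the reals as its space and any sigma-algebra on it.
\<close>

record ('w, 'x, 'y, 'o) protocol =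
  public :: "nat \<Rightarrow> 'w measure"
  randomizer :: "nat \<Rightarrow> 'w \<Rightarrow> 'x \<Rightarrow> 'y list measure"
  analyzer :: "nat \<Rightarrow> 'w \<Rightarrow> 'y list \<Rightarrow> 'o measure"

text \<open>The set of rows \<open>X\<close> is meant to be finite, so no measurability in the row is required.\<close>

definition shuffle_protocol ::
  "'x set \<Rightarrow> 'y measure \<Rightarrow> 'o measure \<Rightarrow> ('w, 'x, 'y, 'o) protocol \<Rightarrow> bool" where
  "shuffle_protocol X Y Z \<P> \<longleftrightarrow>
     (\<forall>n. prob_space (public \<P> n) \<and>
          (\<forall>x\<in>X. (\<lambda>w. randomizer \<P> n w x) \<in> public \<P> n \<rightarrow>\<^sub>M prob_algebra (list_space Y)) \<and>
          (\<lambda>(w, ms). analyzer \<P> n w ms) \<in> public \<P> n \<Otimes>\<^sub>M list_space Y \<rightarrow>\<^sub>M prob_algebra Z)"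

text \<open>
  \<open>shuffled_view Y \<P> n xs\<close> is what is released when the users holding the rows \<open>xs\<close> follow the
  protocol designed for \<open>n\<close> users; \<open>length xs\<close> may differ from \<open>n\<close>. The public random string is
  part of the view: otherwise it could serve as a one-time pad shared by users and analyzer, and
  privacy of the shuffled messages would be void.
\<close>

definition shuffled_view ::
  "'y measure \<Rightarrow> ('w, 'x, 'y, 'o) protocol \<Rightarrow> nat \<Rightarrow> 'x list \<Rightarrow> ('w \<times> 'y list) measure" where
  "shuffled_view Y \<P> n xs =
     do {w \<leftarrow> public \<P> n;
         ms \<leftarrow> shuffled_reports Y (randomizer \<P> n w) xs;
         return (public \<P> n \<Otimes>\<^sub>M list_space Y) (w, ms)}"

definition run_protocol ::
  "'y measure \<Rightarrow> ('w, 'x, 'y, 'o) protocol \<Rightarrow> nat \<Rightarrow> 'x list \<Rightarrow> 'o measure" where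
  "run_protocol Y \<P> n xs = shuffled_view Y \<P> n xs \<bind> (\<lambda>(w, ms). analyzer \<P> n w ms)"

text \<open>\<open>m = \<gamma>' n\<close> users take part; values of \<open>\<gamma>'\<close> for which this is not an integer are void.\<close>

definition robustly_shuffle_private ::
  "'x set \<Rightarrow> 'y measure \<Rightarrow> real \<Rightarrow> real \<Rightarrow> real \<Rightarrow> ('w, 'x, 'y, 'o) protocol \<Rightarrow> bool" where
  "robustly_shuffle_private X Y \<epsilon> \<delta> \<gamma> \<P> \<longleftrightarrow>
     (\<forall>n. \<forall>\<gamma>' \<ge> \<gamma>. \<forall>m. real m = \<gamma>' * real n \<longrightarrow>
        differentially_private X m (public \<P> n \<Otimes>\<^sub>M list_space Y) \<epsilon> \<delta> (shuffled_view Y \<P> n))"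

end

(*
  For each of the N = binom_le d k parities l there are two hypotheses, the uniform distribution u on the
  cube tilted by +beta/2 or -beta/2 along l, with beta/2 > alpha, so that the sign of the released value at
  l tells them apart. Since the tilt by beta/2 is the half-half mixture of u and the tilt by beta, one may
  condition on the number j of users drawing from the latter. The shuffled output does not depend on the
  order of the users, so the tilted users can be put last and replaced by uniform ones one at a time. In
  each replacement the changed user comes last among the users whose rows do not depend on l, and the later
  users are a post-processing of the shuffled messages of the first n - j users. By robust privacy these are
  (eps, delta)-private as long as n - j >= n/3, hence have densities that are, up to an error of mass
  2 delta, within e^eps - 1 of 1, and Bessel's inequality over the orthogonal parities shows that an average
  parity changes the output by at most beta ((e^eps - 1)/sqrt N + 2 delta). By Markov's inequality j
  exceeds 2n/3 with probability at most 3/4, which still contradicts success probability 99/100.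
*)
theory Submission
  imports Defs
begin

subsection \<open>Shuffled messages\<close>

text \<open>Bessel's inequality controls the correlations of all parities with one function of the
  changed row, so the kernel behind that function must be the same for every parity
  \<open>l\<close>. Tilted rows depend on \<open>l\<close>; only the view of the uniform prefix
  together with the changed user does not, which is why privacy of the full run is not enough for
  this argument. If all n users were tilted, some hybrids would have a uniform prefix shorter than
  n/3, where robust privacy says nothing. The half-half mixture keeps about n/2 users uniform in
  every hybrid. The price is Markov's bound: mean n/2 against threshold 2n/3 gives 3/4, and the
  advantage 99/100 - 1/100 exceeds it by 23/100. The gain comes from Cauchy-Schwarz over the N
  parities: the total effect of one user grows like sqrt N, not N. The constants depend on
  \<open>\<epsilon>max\<close> because e^eps - 1 is bounded by a multiple of eps only on a bounded
  range.\<close>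

lemma in_listset_iff: "xs \<in> listset As \<longleftrightarrow> list_all2 (\<in>) xs As"
  by (induction As arbitrary: xs) (auto simp: set_Cons_def list_all2_Cons2)

lemma listset_subset_lists: "As \<in> lists (sets Y) \<Longrightarrow> listset As \<subseteq> lists (space Y)"
proof (induction As)
  case (Cons A As)
  then have "A \<subseteq> space Y" "listset As \<subseteq> lists (space Y)" by (auto dest: sets.sets_into_space)
  then show ?case by (force simp: set_Cons_def subset_iff)
qed simp

lemma space_list_space [simp]: "space (list_space Y) = lists (space Y)"
  unfolding list_space_def by (rule space_measure_of) (use listset_subset_lists in blast)

lemma listset_in_sets: "As \<in> lists (sets Y) \<Longrightarrow> listset As \<in> sets (list_space Y)"
  unfolding list_space_def by (subst sets_measure_of) (use listset_subset_lists in blast)+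

lemma measurable_list_spaceI:
  assumes "f \<in> space M \<rightarrow> lists (space Y)"
    and "\<And>As. As \<in> lists (sets Y) \<Longrightarrow> f -` listset As \<inter> space M \<in> sets M"
  shows "f \<in> M \<rightarrow>\<^sub>M list_space Y"
  unfolding list_space_def
  by (rule measurable_measure_of) (use assms listset_subset_lists in blast)+

text \<open>The preimage of a box is a finite union over the places where the list of sides can be
  cut, and each cut gives a product of two boxes.\<close>

lemma measurable_append [measurable]:
  "(\<lambda>(us, vs). us @ vs) \<in> list_space Y \<Otimes>\<^sub>M list_space Y \<rightarrow>\<^sub>M list_space Y"
proof (rule measurable_list_spaceI)
  fix As assume As: "As \<in> lists (sets Y)"
  have "(\<lambda>(us, vs). us @ vs) -` listset As \<inter> space (list_space Y \<Otimes>\<^sub>M list_space Y) =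
    (\<Union>j\<in>{..length As}. listset (take j As) \<times> listset (drop j As))" (is "?L = ?R")
  proof (intro equalityI subsetI)
    fix z assume "z \<in> ?L"
    then obtain us vs where z: "z = (us, vs)" "list_all2 (\<in>) (us @ vs) As"
      by (cases z) (auto simp: in_listset_iff)
    then obtain Bs Cs where B: "As = Bs @ Cs" "list_all2 (\<in>) us Bs" "list_all2 (\<in>) vs Cs"
      by (auto simp: list_all2_append1)
    then have "length Bs \<in> {..length As}" "take (length Bs) As = Bs" "drop (length Bs) As = Cs"
      by auto
    then show "z \<in> ?R" using B z by (auto simp: in_listset_iff intro!: bexI[of _ "length Bs"])
  next
    fix z assume "z \<in> ?R"
    then obtain j us vs where z: "z = (us, vs)" and
      j: "us \<in> listset (take j As)" "vs \<in> listset (drop j As)" by auto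
    have "take j As \<in> lists (sets Y)" "drop j As \<in> lists (sets Y)"
      using As by (auto dest: in_set_takeD in_set_dropD)
    then have "us \<in> lists (space Y)" "vs \<in> lists (space Y)" using j listset_subset_lists by blast+
    moreover have "us @ vs \<in> listset As"
      using j list_all2_appendI[of "(\<in>)" us "take j As" vs "drop j As"]
      by (simp add: in_listset_iff)
    ultimately show "z \<in> ?L" using z by (auto simp: space_pair_measure)
  qed
  moreover have "listset (take j As) \<times> listset (drop j As) \<in> sets (list_space Y \<Otimes>\<^sub>M list_space Y)" for j
    by (intro pair_measureI listset_in_sets) (use As in \<open>auto dest: in_set_takeD in_set_dropD\<close>)
  ultimately show "(\<lambda>(us, vs). us @ vs) -` listset As \<inter> space (list_space Y \<Otimes>\<^sub>M list_space Y)
      \<in> sets (list_space Y \<Otimes>\<^sub>M list_space Y)"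
    by auto
qed (auto simp: space_pair_measure)

text \<open>Slicing by length is what makes the shuffler tractable, since its group of permutations
  depends on the length of the list.\<close>

lemma length_slice_in_sets: "{ms. length ms = l} \<inter> lists (space Y) \<in> sets (list_space Y)"
proof -
  have "listset (replicate l (space Y)) \<subseteq> lists (space Y)"
    by (rule listset_subset_lists) auto
  moreover have "listset (replicate l S) = {ms. length ms = l \<and> set ms \<subseteq> S}" for S :: "'a set"
    by (induction l) (auto simp: set_Cons_def length_Suc_conv)
  ultimately have "{ms. length ms = l} \<inter> lists (space Y) = listset (replicate l (space Y))"
    by (auto simp: lists_eq_set)
  also have "\<dots> \<in> sets (list_space Y)" by (rule listset_in_sets) auto
  finally show ?thesis .
qed

text \<open>On lists of the right length, the preimage of a box is the box whose sides are permuted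
  by the inverse of \<open>\<sigma>\<close>; a box of another length has empty preimage.\<close>

lemma measurable_permute_list:
  assumes \<sigma>: "\<sigma> permutes {..<l}"
  shows "permute_list \<sigma> \<in> restrict_space (list_space Y) {ms. length ms = l} \<rightarrow>\<^sub>M list_space Y"
proof (rule measurable_list_spaceI)
  have sp: "space (restrict_space (list_space Y) {ms. length ms = l}) = {ms. length ms = l} \<inter> lists (space Y)"
    by (auto simp: space_restrict_space)
  show "permute_list \<sigma> \<in> space (restrict_space (list_space Y) {ms. length ms = l}) \<rightarrow> lists (space Y)"
    using \<sigma> unfolding sp by (auto simp: set_permute_list)
  fix As assume As: "As \<in> lists (sets Y)"
  show "permute_list \<sigma> -` listset As \<inter> space (restrict_space (list_space Y) {ms. length ms = l})
    \<in> sets (restrict_space (list_space Y) {ms. length ms = l})"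
  proof (cases "length As = l")
    case False
    then have "permute_list \<sigma> -` listset As \<inter> space (restrict_space (list_space Y) {ms. length ms = l}) = {}"
      unfolding sp by (auto simp: in_listset_iff dest!: list_all2_lengthD)
    then show ?thesis by simp
  next
    case True
    let ?Bs = "permute_list (inv \<sigma>) As"
    have inv: "inv \<sigma> permutes {..<l}" by (rule permutes_inv[OF \<sigma>])
    have Bs: "?Bs \<in> lists (sets Y)" using As inv True by (auto simp: set_permute_list)
    have iff: "list_all2 (\<in>) (permute_list \<sigma> ms) As \<longleftrightarrow> list_all2 (\<in>) ms ?Bs" if "length ms = l" for ms
    proof -
      have "list_all2 (\<in>) (permute_list \<sigma> ms) As \<longleftrightarrow> (\<forall>i\<in>{..<l}. ms ! \<sigma> i \<in> As ! i)"
        using that True \<sigma> by (auto simp: list_all2_conv_all_nth permute_list_nth)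
      also have "\<dots> \<longleftrightarrow> (\<forall>i\<in>\<sigma> ` {..<l}. ms ! i \<in> As ! inv \<sigma> i)"
        by (auto simp: permutes_inverses[OF \<sigma>])
      also have "\<sigma> ` {..<l} = {..<l}" by (rule permutes_image[OF \<sigma>])
      also have "(\<forall>i\<in>{..<l}. ms ! i \<in> As ! inv \<sigma> i) \<longleftrightarrow> list_all2 (\<in>) ms ?Bs"
        using that True inv by (auto simp: list_all2_conv_all_nth permute_list_nth)
      finally show ?thesis .
    qed
    have "permute_list \<sigma> -` listset As \<inter> space (restrict_space (list_space Y) {ms. length ms = l}) =
       {ms. length ms = l} \<inter> listset ?Bs"
      using listset_subset_lists[OF Bs] unfolding sp by (auto simp: in_listset_iff iff)
    then show ?thesis
      using listset_in_sets[OF Bs] by (simp add: sets_restrict_space)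
  qed
qed


text \<open>\<open>permute_list \<sigma> ms\<close> leaves \<open>list_space Y\<close> if \<open>\<sigma>\<close> is no permutation, so the map in
  \<open>shuffler\<close> is measurable only after a correction on a null set.\<close>

lemma shuffler_eq_distr:
  "shuffler Y ms = distr (measure_pmf (pmf_of_set {\<sigma>. \<sigma> permutes {..<length ms}})) (list_space Y)
     (\<lambda>\<sigma>. if \<sigma> permutes {..<length ms} then permute_list \<sigma> ms else ms)" (is "_ = distr (measure_pmf ?p) _ ?f")
proof -
  have p: "set_pmf ?p = {\<sigma>. \<sigma> permutes {..<length ms}}"
    by (rule set_pmf_of_set) (auto intro: finite_permutations permutes_id)
  have "emeasure (measure_pmf ?p) ((\<lambda>\<sigma>. permute_list \<sigma> ms) -` A) = emeasure (measure_pmf ?p) (?f -` A)" for A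
    by (subst (1 2) emeasure_Int_set_pmf[symmetric]) (auto simp: p intro!: arg_cong2[where f=emeasure])
  then show ?thesis unfolding shuffler_def distr_def by simp
qed

section \<open>The shuffler as a Markov kernel on message lists\<close>

lemma measurable_shuffle:
  assumes "ms \<in> lists (space Y)"
  shows "(\<lambda>\<sigma>. if \<sigma> permutes {..<length ms} then permute_list \<sigma> ms else ms) \<in> measure_pmf p \<rightarrow>\<^sub>M list_space Y"
  using assms by (auto simp: measurable_def set_permute_list split: if_splits)

lemma sets_shuffler [simp]: "sets (shuffler Y ms) = sets (list_space Y)"
  by (simp add: shuffler_def)

lemma prob_space_shuffler: "ms \<in> lists (space Y) \<Longrightarrow> prob_space (shuffler Y ms)"
  unfolding shuffler_eq_distr
  by (intro prob_space.prob_space_distr measure_pmf.prob_space_axioms measurable_shuffle)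

lemma nn_integral_shuffler:
  assumes "ms \<in> lists (space Y)" "h \<in> borel_measurable (list_space Y)"
  shows "(\<integral>\<^sup>+ms'. h ms' \<partial>shuffler Y ms) =
    (\<Sum>\<sigma> | \<sigma> permutes {..<length ms}. h (permute_list \<sigma> ms)) / fact (length ms)"
proof -
  have "{\<sigma>. \<sigma> permutes {..<length ms}} \<noteq> {}" "finite {\<sigma>. \<sigma> permutes {..<length ms}}"
    by (auto intro: finite_permutations permutes_id)
  then show ?thesis
    unfolding shuffler_eq_distr
    by (subst nn_integral_distr[OF measurable_shuffle[OF assms(1)]], use assms(2) in simp)
       (subst nn_integral_pmf_of_set, auto simp: card_permutations intro!: arg_cong2[where f="(/)"] sum.cong)
qed

text \<open>On each of the countably many length slices the kernel is a finite average of the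
  measurable maps \<open>permute_list \<sigma>\<close>; the slices are then glued together.\<close>

lemma measurable_shuffler: "shuffler Y \<in> list_space Y \<rightarrow>\<^sub>M prob_algebra (list_space Y)"
proof (intro measurable_prob_algebraI measurable_subprob_algebra)
  fix A assume A: "A \<in> sets (list_space Y)"
  have "(\<lambda>ms. \<integral>\<^sup>+ms'. indicator A ms' \<partial>shuffler Y ms) \<in> borel_measurable (list_space Y)"
  proof (rule measurable_piecewise_restrict[where C="range (\<lambda>l. {ms. length ms = l})"])
    fix S :: "'a list set" assume "S \<in> range (\<lambda>l. {ms. length ms = l})"
    then obtain l where S: "S = {ms. length ms = l}" by auto
    show "S \<inter> space (list_space Y) \<in> sets (list_space Y)"
      using length_slice_in_sets[of l Y] by (simp add: S)
    have [measurable]: "permute_list \<sigma> \<in> restrict_space (list_space Y) S \<rightarrow>\<^sub>M list_space Y"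
      if "\<sigma> permutes {..<l}" for \<sigma> using measurable_permute_list[OF that] unfolding S .
    have "(\<lambda>ms. (\<Sum>\<sigma> | \<sigma> permutes {..<l}. indicator A (permute_list \<sigma> ms)) / fact l :: ennreal)
      \<in> borel_measurable (restrict_space (list_space Y) S)"
      by (intro borel_measurable_divide_ennreal borel_measurable_sum measurable_const
        measurable_compose[OF _ borel_measurable_indicator[OF A]]) auto
    then show "(\<lambda>ms. \<integral>\<^sup>+ms'. indicator A ms' \<partial>shuffler Y ms) \<in> borel_measurable (restrict_space (list_space Y) S)"
    proof (rule measurable_cong[THEN iffD1, rotated])
      fix ms assume "ms \<in> space (restrict_space (list_space Y) S)"
      then have ms: "ms \<in> lists (space Y)" "length ms = l" by (auto simp: space_restrict_space S)
      show "(\<Sum>\<sigma> | \<sigma> permutes {..<l}. indicator A (permute_list \<sigma> ms)) / fact l =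
        (\<integral>\<^sup>+ms'. indicator A ms' \<partial>shuffler Y ms)"
        unfolding nn_integral_shuffler[OF ms(1) borel_measurable_indicator[OF A]] ms(2) ..
    qed
  qed auto
  then show "(\<lambda>ms. emeasure (shuffler Y ms) A) \<in> borel_measurable (list_space Y)"
    using A by simp
qed (auto intro: prob_space_shuffler prob_space_imp_subprob_space)

section \<open>Reports of independent users and their invariance under reordering\<close>

lemma measurable_reports:
  assumes "\<And>x. x \<in> set xs \<Longrightarrow> (\<lambda>w. R w x) \<in> M \<rightarrow>\<^sub>M prob_algebra (list_space Y)"
  shows "(\<lambda>w. reports Y (R w) xs) \<in> M \<rightarrow>\<^sub>M prob_algebra (list_space Y)"
  using assms
proof (induction xs)
  case Nil
  have "return (list_space Y) [] \<in> space (prob_algebra (list_space Y))"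
    by (auto simp: space_prob_algebra prob_space_return)
  then show ?case by simp
next
  case (Cons x xs)
  then have [measurable]: "(\<lambda>w. R w x) \<in> M \<rightarrow>\<^sub>M prob_algebra (list_space Y)"
    "(\<lambda>w. reports Y (R w) xs) \<in> M \<rightarrow>\<^sub>M prob_algebra (list_space Y)" by auto
  show ?case by simp measurable
qed

lemma measurable_shuffled_reports:
  assumes "\<And>x. x \<in> set xs \<Longrightarrow> (\<lambda>w. R w x) \<in> M \<rightarrow>\<^sub>M prob_algebra (list_space Y)"
  shows "(\<lambda>w. shuffled_reports Y (R w) xs) \<in> M \<rightarrow>\<^sub>M prob_algebra (list_space Y)"
  unfolding shuffled_reports_def
  by (rule measurable_bind_prob_space[OF measurable_reports measurable_shuffler]) (use assms in auto)

lemma reports_in_prob_algebra: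
  assumes "\<And>x. x \<in> set xs \<Longrightarrow> R x \<in> space (prob_algebra (list_space Y))"
  shows "reports Y R xs \<in> space (prob_algebra (list_space Y))"
  using measurable_space[OF measurable_reports[where R="\<lambda>_. R" and xs=xs and M="count_space UNIV"]] assms
  by auto

lemma sets_reports:
  assumes "\<And>x. x \<in> set xs \<Longrightarrow> R x \<in> space (prob_algebra (list_space Y))"
  shows "sets (reports Y R xs) = sets (list_space Y)"
  using reports_in_prob_algebra[where R=R and xs=xs and Y=Y] assms by (simp add: space_prob_algebra)

lemma nn_integral_reports_Cons:
  assumes R: "\<And>z. z \<in> insert x (set xs) \<Longrightarrow> R z \<in> space (prob_algebra (list_space Y))"
    and h [measurable]: "h \<in> borel_measurable (list_space Y)"
  shows "(\<integral>\<^sup>+us. h us \<partial>reports Y R (x # xs)) =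
    (\<integral>\<^sup>+us. \<integral>\<^sup>+vs. h (us @ vs) \<partial>reports Y R xs \<partial>R x)"
proof -
  let ?L = "list_space Y"
  have Rx: "R x \<in> space (prob_algebra ?L)" and Rxs: "reports Y R xs \<in> space (prob_algebra ?L)"
    using R by (auto intro: reports_in_prob_algebra)
  have [measurable_cong]: "sets (R x) = sets ?L" "sets (reports Y R xs) = sets ?L"
    using Rx Rxs by (auto simp: space_prob_algebra)
  have [measurable]: "(\<lambda>_. reports Y R xs) \<in> R x \<rightarrow>\<^sub>M prob_algebra ?L" using Rxs by simp
  have "(\<integral>\<^sup>+us. h us \<partial>reports Y R (x # xs)) =
    (\<integral>\<^sup>+us. \<integral>\<^sup>+vs. h vs \<partial>(reports Y R xs \<bind> (\<lambda>vs. return ?L (us @ vs))) \<partial>R x)"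
    unfolding reports.simps
    by (rule nn_integral_bind[OF h]) (rule measurable_prob_algebraD, measurable)
  also have "\<dots> = (\<integral>\<^sup>+us. \<integral>\<^sup>+vs. h (us @ vs) \<partial>reports Y R xs \<partial>R x)"
  proof (rule nn_integral_cong)
    fix us assume "us \<in> space (R x)"
    then have us [measurable]: "us \<in> space ?L" using sets_eq_imp_space_eq[OF \<open>sets (R x) = sets ?L\<close>] by blast
    have "(\<integral>\<^sup>+vs. h vs \<partial>(reports Y R xs \<bind> (\<lambda>vs. return ?L (us @ vs)))) =
      (\<integral>\<^sup>+vs. \<integral>\<^sup>+ vs. h vs \<partial>return ?L (us @ vs) \<partial>reports Y R xs)"
      by (rule nn_integral_bind[OF h]) (rule measurable_prob_algebraD, measurable)
    also have "\<dots> = (\<integral>\<^sup>+vs. h (us @ vs) \<partial>reports Y R xs)"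
      using us sets_eq_imp_space_eq[OF \<open>sets (reports Y R xs) = sets ?L\<close>]
      by (intro nn_integral_cong nn_integral_return h) auto
    finally show "(\<integral>\<^sup>+vs. h vs \<partial>(reports Y R xs \<bind> (\<lambda>vs. return ?L (us @ vs)))) =
       (\<integral>\<^sup>+vs. h (us @ vs) \<partial>reports Y R xs)" .
  qed
  finally show ?thesis .
qed

lemma measurable_append_left:
  assumes "us \<in> lists (space Y)"
  shows "(\<lambda>vs. us @ vs) \<in> list_space Y \<rightarrow>\<^sub>M list_space Y"
proof -
  have "(\<lambda>vs. case (us, vs) of (us, vs) \<Rightarrow> us @ vs) \<in> list_space Y \<rightarrow>\<^sub>M list_space Y"
    by (rule measurable_compose[OF measurable_Pair1' measurable_append]) (use assms in simp)
  then show ?thesis by simp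
qed

lemma nn_integral_reports_append:
  assumes R: "\<And>z. z \<in> set xs \<union> set ys \<Longrightarrow> R z \<in> space (prob_algebra (list_space Y))"
    and h: "h \<in> borel_measurable (list_space Y)"
  shows "(\<integral>\<^sup>+us. h us \<partial>reports Y R (xs @ ys)) =
    (\<integral>\<^sup>+us. \<integral>\<^sup>+vs. h (us @ vs) \<partial>reports Y R ys \<partial>reports Y R xs)"
  using R h
proof (induction xs arbitrary: h)
  case Nil
  have ys: "reports Y R ys \<in> space (prob_algebra (list_space Y))"
    using Nil by (intro reports_in_prob_algebra) auto
  then have [measurable_cong]: "sets (reports Y R ys) = sets (list_space Y)"
    by (simp add: space_prob_algebra)
  note [measurable] = \<open>h \<in> borel_measurable (list_space Y)\<close>
  interpret prob_space "reports Y R ys" using ys by (simp add: space_prob_algebra)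
  have "(\<lambda>us. \<integral>\<^sup>+ vs. h (us @ vs) \<partial>reports Y R ys) \<in> borel_measurable (list_space Y)"
    by measurable
  then show ?case by (simp add: nn_integral_return)
next
  case (Cons x xs)
  let ?L = "list_space Y"
  have ys: "reports Y R ys \<in> space (prob_algebra ?L)"
    using Cons.prems by (intro reports_in_prob_algebra) auto
  then have [measurable_cong]: "sets (reports Y R ys) = sets ?L"
    by (simp add: space_prob_algebra)
  note h [measurable] = \<open>h \<in> borel_measurable (list_space Y)\<close>
  interpret prob_space "reports Y R ys" using ys by (simp add: space_prob_algebra)
  have m: "(\<lambda>us. \<integral>\<^sup>+ vs. h (us @ vs) \<partial>reports Y R ys) \<in> borel_measurable ?L"
    by measurable
  have "sets (R x) = sets ?L" using Cons.prems(1)[of x] by (simp add: space_prob_algebra)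
  then have sp: "space (R x) = lists (space Y)" by (metis sets_eq_imp_space_eq space_list_space)
  have "(\<integral>\<^sup>+us. h us \<partial>reports Y R (x # xs @ ys)) =
    (\<integral>\<^sup>+us. \<integral>\<^sup>+vs. h (us @ vs) \<partial>reports Y R (xs @ ys) \<partial>R x)"
    using Cons.prems by (intro nn_integral_reports_Cons) auto
  also have "\<dots> = (\<integral>\<^sup>+us. \<integral>\<^sup>+vs. \<integral>\<^sup>+vs'. h (us @ vs @ vs') \<partial>reports Y R ys \<partial>reports Y R xs \<partial>R x)"
    using sp Cons.prems
    by (intro nn_integral_cong Cons.IH measurable_compose[OF measurable_append_left h]) auto
  also have "\<dots> = (\<integral>\<^sup>+us. \<integral>\<^sup>+vs. h (us @ vs) \<partial>reports Y R ys \<partial>reports Y R (x # xs))"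
    using Cons.prems by (subst nn_integral_reports_Cons[OF _ m]) auto
  finally show ?case by simp
qed

text \<open>Tonelli exchanges the two independent blocks of users, and the symmetry of
  \<open>h\<close> absorbs the changed order of concatenation.\<close>

lemma nn_integral_reports_swap:
  assumes R: "\<And>z. z \<in> set xs \<union> set ys \<Longrightarrow> R z \<in> space (prob_algebra (list_space Y))"
    and h: "h \<in> borel_measurable (list_space Y)"
    and symm: "\<And>us vs. us \<in> lists (space Y) \<Longrightarrow> mset us = mset vs \<Longrightarrow> h us = h vs"
  shows "(\<integral>\<^sup>+us. h us \<partial>reports Y R (xs @ ys)) = (\<integral>\<^sup>+us. h us \<partial>reports Y R (ys @ xs))"
proof -
  let ?L = "list_space Y"
  have xs: "reports Y R xs \<in> space (prob_algebra ?L)" and ys: "reports Y R ys \<in> space (prob_algebra ?L)"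
    using R by (auto intro!: reports_in_prob_algebra)
  interpret X: prob_space "reports Y R xs" using xs by (simp add: space_prob_algebra)
  interpret Y: prob_space "reports Y R ys" using ys by (simp add: space_prob_algebra)
  interpret P: pair_sigma_finite "reports Y R xs" "reports Y R ys" ..
  note [measurable] = h
  have s: "sets (reports Y R xs) = sets ?L" "sets (reports Y R ys) = sets ?L"
    using xs ys by (simp_all add: space_prob_algebra)
  note [measurable_cong] = s
  have sp: "space (reports Y R xs) = lists (space Y)" "space (reports Y R ys) = lists (space Y)"
    using s[THEN sets_eq_imp_space_eq] by auto
  have "(\<integral>\<^sup>+us. h us \<partial>reports Y R (xs @ ys)) =
    (\<integral>\<^sup>+us. \<integral>\<^sup>+vs. h (us @ vs) \<partial>reports Y R ys \<partial>reports Y R xs)"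
    using assms by (intro nn_integral_reports_append) auto
  also have "\<dots> = (\<integral>\<^sup>+vs. \<integral>\<^sup>+us. h (us @ vs) \<partial>reports Y R xs \<partial>reports Y R ys)"
    by (rule P.Fubini'[symmetric]) measurable
  also have "\<dots> = (\<integral>\<^sup>+vs. \<integral>\<^sup>+us. h (vs @ us) \<partial>reports Y R xs \<partial>reports Y R ys)"
    by (intro nn_integral_cong symm) (auto simp: sp)
  also have "\<dots> = (\<integral>\<^sup>+us. h us \<partial>reports Y R (ys @ xs))"
    using assms by (intro nn_integral_reports_append[symmetric]) auto
  finally show ?thesis .
qed

text \<open>The head \<open>x\<close> occurs in \<open>ys = as @ x # bs\<close>. Rotating
  \<open>as\<close> to the end is a swap of two blocks and brings \<open>x\<close> to the front, so
  the induction hypothesis applies to \<open>xs\<close> and \<open>bs @ as\<close>.\<close>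

lemma nn_integral_reports_mset:
  assumes "\<And>z. z \<in> set xs \<Longrightarrow> R z \<in> space (prob_algebra (list_space Y))"
    and "h \<in> borel_measurable (list_space Y)"
    and "\<And>us vs. us \<in> lists (space Y) \<Longrightarrow> mset us = mset vs \<Longrightarrow> h us = h vs"
    and "mset xs = mset ys"
  shows "(\<integral>\<^sup>+us. h us \<partial>reports Y R xs) = (\<integral>\<^sup>+us. h us \<partial>reports Y R ys)"
  using assms
proof (induction xs arbitrary: ys h)
  case (Cons x xs)
  let ?L = "list_space Y"
  note R = Cons.prems(1) and h = Cons.prems(2) and symm = Cons.prems(3)
  have set_ys: "set ys = set (x # xs)" using Cons.prems(4) by (metis mset_eq_setD)
  then obtain as bs where ys: "ys = as @ x # bs" by (metis in_set_conv_decomp list.set_intros(1))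
  have sub: "set as \<union> set (x # bs) = set (x # xs)" "set xs = set (bs @ as)"
    using set_ys mset_eq_setD[of xs "bs @ as"] Cons.prems(4) ys by auto
  have "sets (R x) = sets ?L" using R[of x] by (simp add: space_prob_algebra)
  then have sp: "space (R x) = lists (space Y)" by (metis sets_eq_imp_space_eq space_list_space)
  have "(\<integral>\<^sup>+us. h us \<partial>reports Y R (x # xs)) =
    (\<integral>\<^sup>+us. \<integral>\<^sup>+vs. h (us @ vs) \<partial>reports Y R xs \<partial>R x)"
    using R h by (intro nn_integral_reports_Cons) auto
  also have "\<dots> = (\<integral>\<^sup>+us. \<integral>\<^sup>+vs. h (us @ vs) \<partial>reports Y R (bs @ as) \<partial>R x)"
    using R h Cons.prems(4) sp ys
    by (intro nn_integral_cong Cons.IH measurable_compose[OF measurable_append_left h] symm) auto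
  also have "\<dots> = (\<integral>\<^sup>+us. h us \<partial>reports Y R ((x # bs) @ as))"
    unfolding append_Cons by (rule nn_integral_reports_Cons[symmetric]) (use R h sub in auto)
  also have "\<dots> = (\<integral>\<^sup>+us. h us \<partial>reports Y R ys)"
    unfolding ys using R h symm sub by (intro nn_integral_reports_swap) blast+
  finally show ?case .
qed simp

text \<open>A symmetric statistic cannot see the shuffle. Hence a prefix of the messages may be
  shuffled on its own at no cost before further messages are appended.\<close>

lemma nn_integral_shuffler_symmetric:
  assumes ms: "ms \<in> lists (space Y)"
    and symm: "\<And>us vs. us \<in> lists (space Y) \<Longrightarrow> mset us = mset vs \<Longrightarrow> h us = h vs"
    and h: "h \<in> borel_measurable (list_space Y)"
  shows "(\<integral>\<^sup>+ms'. h ms' \<partial>shuffler Y ms) = h ms"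
proof -
  have "(\<integral>\<^sup>+ms'. h ms' \<partial>shuffler Y ms) =
     (\<integral>\<^sup>+\<sigma>. h (if \<sigma> permutes {..<length ms} then permute_list \<sigma> ms else ms)
        \<partial>measure_pmf (pmf_of_set {\<sigma>. \<sigma> permutes {..<length ms}}))"
    unfolding shuffler_eq_distr
    by (rule nn_integral_distr[OF measurable_shuffle[OF ms]]) (use h in simp)
  also have "\<dots> = (\<integral>\<^sup>+\<sigma>. h ms \<partial>measure_pmf (pmf_of_set {\<sigma>. \<sigma> permutes {..<length ms}}))"
    by (intro nn_integral_cong) (auto intro: symm[OF ms, symmetric])
  finally show ?thesis by simp
qed

text \<open>Lists with equal multisets differ by a permutation \<open>\<tau>\<close>, and composing
  with \<open>\<tau>\<close> merely reindexes the sum over the symmetric group.\<close>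

lemma shuffler_mset:
  assumes us: "us \<in> lists (space Y)" and eq: "mset us = mset vs"
    and h: "h \<in> borel_measurable (list_space Y)"
  shows "(\<integral>\<^sup>+ms. h ms \<partial>shuffler Y us) = (\<integral>\<^sup>+ms. h ms \<partial>shuffler Y vs)"
proof -
  obtain \<tau> where \<tau>: "\<tau> permutes {..<length vs}" "permute_list \<tau> vs = us"
    using mset_eq_permutation[OF eq] by metis
  have len: "length us = length vs" and vs: "vs \<in> lists (space Y)"
    using eq us mset_eq_setD[OF eq] by (auto dest: mset_eq_length)
  have "(\<Sum>\<sigma> | \<sigma> permutes {..<length vs}. h (permute_list \<sigma> us)) =
    (\<Sum>\<sigma> | \<sigma> permutes {..<length vs}. h (permute_list (\<tau> \<circ> \<sigma>) vs))"
    using \<tau> by (intro sum.cong) (auto simp: permute_list_compose)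
  also have "\<dots> = (\<Sum>\<sigma> | \<sigma> permutes {..<length vs}. h (permute_list \<sigma> vs))"
    by (rule setum_permutations_compose_left[OF \<tau>(1), symmetric])
  finally show ?thesis
    by (simp add: nn_integral_shuffler us vs h len)
qed

lemma nn_integral_shuffled_reports:
  assumes R: "\<And>z. z \<in> set xs \<Longrightarrow> R z \<in> space (prob_algebra (list_space Y))"
    and h: "h \<in> borel_measurable (list_space Y)"
  shows "(\<integral>\<^sup>+ms. h ms \<partial>shuffled_reports Y R xs) = (\<integral>\<^sup>+us. \<integral>\<^sup>+ms. h ms \<partial>shuffler Y us \<partial>reports Y R xs)"
proof -
  have "sets (reports Y R xs) = sets (list_space Y)"
    by (rule sets_reports[OF R])
  then have "shuffler Y \<in> reports Y R xs \<rightarrow>\<^sub>M subprob_algebra (list_space Y)"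
    using measurable_prob_algebraD[OF measurable_shuffler] measurable_cong_sets by blast
  from nn_integral_bind[OF h this] show ?thesis unfolding shuffled_reports_def .
qed

lemma nn_integral_shuffled_reports_symmetric:
  assumes R: "\<And>z. z \<in> set xs \<Longrightarrow> R z \<in> space (prob_algebra (list_space Y))"
    and h: "h \<in> borel_measurable (list_space Y)"
    and symm: "\<And>us vs. us \<in> lists (space Y) \<Longrightarrow> mset us = mset vs \<Longrightarrow> h us = h vs"
  shows "(\<integral>\<^sup>+ms. h ms \<partial>shuffled_reports Y R xs) = (\<integral>\<^sup>+ms. h ms \<partial>reports Y R xs)"
proof -
  have "sets (reports Y R xs) = sets (list_space Y)"
    by (rule sets_reports[OF R])
  then have "space (reports Y R xs) = lists (space Y)" by (metis sets_eq_imp_space_eq space_list_space)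
  then show ?thesis
    using nn_integral_shuffled_reports[where R=R and xs=xs, OF R h]
    by (simp, intro nn_integral_cong nn_integral_shuffler_symmetric symm h) auto
qed

section \<open>Views and runs of a protocol\<close>

lemma nn_integral_shuffled_view:
  assumes P: "prob_space (public \<P> n)"
    and R: "\<And>x. x \<in> set xs \<Longrightarrow> (\<lambda>w. randomizer \<P> n w x) \<in> public \<P> n \<rightarrow>\<^sub>M prob_algebra (list_space Y)"
    and \<phi> [measurable]: "\<phi> \<in> borel_measurable (public \<P> n \<Otimes>\<^sub>M list_space Y)"
  shows "(\<integral>\<^sup>+z. \<phi> z \<partial>shuffled_view Y \<P> n xs) =
    (\<integral>\<^sup>+w. \<integral>\<^sup>+ms. \<phi> (w, ms) \<partial>shuffled_reports Y (randomizer \<P> n w) xs \<partial>public \<P> n)"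
proof -
  let ?P = "public \<P> n" and ?L = "list_space Y" and ?S = "\<lambda>w. shuffled_reports Y (randomizer \<P> n w) xs"
  have S [measurable]: "?S \<in> ?P \<rightarrow>\<^sub>M prob_algebra ?L" by (rule measurable_shuffled_reports[OF R])
  have "(\<integral>\<^sup>+z. \<phi> z \<partial>shuffled_view Y \<P> n xs) =
    (\<integral>\<^sup>+w. \<integral>\<^sup>+z. \<phi> z \<partial>(?S w \<bind> (\<lambda>ms. return (?P \<Otimes>\<^sub>M ?L) (w, ms))) \<partial>?P)"
    unfolding shuffled_view_def
    by (rule nn_integral_bind[OF \<phi>]) (rule measurable_prob_algebraD, measurable)
  also have "\<dots> = (\<integral>\<^sup>+w. \<integral>\<^sup>+ms. \<phi> (w, ms) \<partial>?S w \<partial>?P)"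
  proof (rule nn_integral_cong)
    fix w assume w [measurable]: "w \<in> space ?P"
    have s [measurable_cong]: "sets (?S w) = sets ?L"
      using measurable_space[OF S w] by (simp add: space_prob_algebra)
    have "(\<integral>\<^sup>+z. \<phi> z \<partial>(?S w \<bind> (\<lambda>ms. return (?P \<Otimes>\<^sub>M ?L) (w, ms)))) =
      (\<integral>\<^sup>+ms. \<integral>\<^sup>+z. \<phi> z \<partial>return (?P \<Otimes>\<^sub>M ?L) (w, ms) \<partial>?S w)"
      by (rule nn_integral_bind[OF \<phi>]) (rule measurable_prob_algebraD, measurable)
    also have "\<dots> = (\<integral>\<^sup>+ms. \<phi> (w, ms) \<partial>?S w)"
      using w sets_eq_imp_space_eq[OF s]
      by (intro nn_integral_cong nn_integral_return \<phi>) (auto simp: space_pair_measure)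
    finally show "(\<integral>\<^sup>+z. \<phi> z \<partial>(?S w \<bind> (\<lambda>ms. return (?P \<Otimes>\<^sub>M ?L) (w, ms)))) =
      (\<integral>\<^sup>+ms. \<phi> (w, ms) \<partial>?S w)" .
  qed
  finally show ?thesis .
qed

lemma shuffled_view_in_prob_algebra:
  assumes P: "prob_space (public \<P> n)"
    and R: "\<And>x. x \<in> set xs \<Longrightarrow> (\<lambda>w. randomizer \<P> n w x) \<in> public \<P> n \<rightarrow>\<^sub>M prob_algebra (list_space Y)"
  shows "shuffled_view Y \<P> n xs \<in> space (prob_algebra (public \<P> n \<Otimes>\<^sub>M list_space Y))"
proof -
  let ?P = "public \<P> n" and ?L = "list_space Y" and ?S = "\<lambda>w. shuffled_reports Y (randomizer \<P> n w) xs"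
  have S [measurable]: "?S \<in> ?P \<rightarrow>\<^sub>M prob_algebra ?L" by (rule measurable_shuffled_reports[OF R])
  have [measurable]: "?P \<in> space (prob_algebra ?P)" using P by (simp add: space_prob_algebra)
  have "(\<lambda>_. shuffled_view Y \<P> n xs) \<in> count_space UNIV \<rightarrow>\<^sub>M prob_algebra (?P \<Otimes>\<^sub>M ?L)"
    unfolding shuffled_view_def by measurable
  from measurable_space[OF this, of undefined] show ?thesis by simp
qed

lemma run_protocol_in_prob_algebra:
  assumes \<P>: "shuffle_protocol X Y Z \<P>" and xs: "xs \<in> lists X"
  shows "run_protocol Y \<P> n xs \<in> space (prob_algebra Z)"
proof -
  have V: "shuffled_view Y \<P> n xs \<in> space (prob_algebra (public \<P> n \<Otimes>\<^sub>M list_space Y))"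
    by (rule shuffled_view_in_prob_algebra) (use \<P> xs in \<open>auto simp: shuffle_protocol_def\<close>)
  have A: "(\<lambda>(w, ms). analyzer \<P> n w ms) \<in> public \<P> n \<Otimes>\<^sub>M list_space Y \<rightarrow>\<^sub>M prob_algebra Z"
    using \<P> by (auto simp: shuffle_protocol_def)
  show ?thesis
    unfolding run_protocol_def space_prob_algebra
    using prob_space_bind'[OF V A] sets_bind'[OF V A] by simp
qed

text \<open>Averaging the acceptance probability over the shuffle gives a function \<open>s\<close> of the multiset of
  messages; hence the order of the users is irrelevant, and the messages of the users holding \<open>us\<close> may be
  shuffled among themselves before the other messages are added.\<close>

lemma emeasure_run_protocol:
  assumes \<P>: "shuffle_protocol X Y Z \<P>" and E: "E \<in> sets Z"
  obtains s where "(\<lambda>(w, ms). s w ms) \<in> borel_measurable (public \<P> n \<Otimes>\<^sub>M list_space Y)"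
    and "\<And>w us vs. w \<in> space (public \<P> n) \<Longrightarrow> us \<in> lists (space Y) \<Longrightarrow> mset us = mset vs \<Longrightarrow> s w us = s w vs"
    and "\<And>xs. xs \<in> lists X \<Longrightarrow> emeasure (run_protocol Y \<P> n xs) E =
      (\<integral>\<^sup>+w. \<integral>\<^sup>+us. s w us \<partial>reports Y (randomizer \<P> n w) xs \<partial>public \<P> n)"
    and "\<And>w us. w \<in> space (public \<P> n) \<Longrightarrow> us \<in> lists (space Y) \<Longrightarrow> s w us \<le> 1"
proof
  let ?P = "public \<P> n" and ?L = "list_space Y" and ?A = "\<lambda>(w, ms). analyzer \<P> n w ms"
  let ?s = "\<lambda>w us. \<integral>\<^sup>+ms. emeasure (analyzer \<P> n w ms) E \<partial>shuffler Y us"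
  have A: "?A \<in> ?P \<Otimes>\<^sub>M ?L \<rightarrow>\<^sub>M prob_algebra Z" and P: "prob_space ?P"
    and R: "\<And>x. x \<in> X \<Longrightarrow> (\<lambda>w. randomizer \<P> n w x) \<in> ?P \<rightarrow>\<^sub>M prob_algebra ?L"
    using \<P> by (auto simp: shuffle_protocol_def)
  have a: "(\<lambda>z. emeasure (?A z) E) \<in> borel_measurable (?P \<Otimes>\<^sub>M ?L)"
    by (rule measurable_compose[OF measurable_prob_algebraD[OF A] measurable_emeasure_subprob_algebra[OF E]])
  then have a' [measurable]: "(\<lambda>(w, ms). emeasure (analyzer \<P> n w ms) E) \<in> borel_measurable (?P \<Otimes>\<^sub>M ?L)"
    by (simp add: case_prod_beta)
  have aw: "(\<lambda>ms. emeasure (analyzer \<P> n w ms) E) \<in> borel_measurable ?L" if [measurable]: "w \<in> space ?P" for w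
    by measurable
  have shuf [measurable]: "shuffler Y \<in> ?L \<rightarrow>\<^sub>M subprob_algebra ?L"
    by (rule measurable_prob_algebraD[OF measurable_shuffler])
  have m: "(\<lambda>(z, ms). case z of (w, us) \<Rightarrow> emeasure (analyzer \<P> n w ms) E) \<in> borel_measurable ((?P \<Otimes>\<^sub>M ?L) \<Otimes>\<^sub>M ?L)"
    by measurable
  have "(\<lambda>z. \<integral>\<^sup>+ms. (case z of (w, us) \<Rightarrow> emeasure (analyzer \<P> n w ms) E) \<partial>shuffler Y (snd z)) \<in> borel_measurable (?P \<Otimes>\<^sub>M ?L)"
    by (rule nn_integral_measurable_subprob_algebra2[OF m]) measurable
  then show "(\<lambda>(w, us). ?s w us) \<in> borel_measurable (?P \<Otimes>\<^sub>M ?L)"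
    by (simp add: case_prod_beta)
  show "?s w us = ?s w vs" if "w \<in> space ?P" "us \<in> lists (space Y)" "mset us = mset vs" for w us vs
    using that by (intro shuffler_mset aw)
  fix xs assume xs: "xs \<in> lists X"
  have Rx: "(\<lambda>w. randomizer \<P> n w x) \<in> ?P \<rightarrow>\<^sub>M prob_algebra ?L" if "x \<in> set xs" for x
    using R xs that by auto
  have V: "shuffled_view Y \<P> n xs \<in> space (prob_algebra (?P \<Otimes>\<^sub>M ?L))"
    by (rule shuffled_view_in_prob_algebra[OF P Rx])
  then have V': "sets (shuffled_view Y \<P> n xs) = sets (?P \<Otimes>\<^sub>M ?L)" "prob_space (shuffled_view Y \<P> n xs)"
    by (auto simp: space_prob_algebra)
  have AV: "?A \<in> shuffled_view Y \<P> n xs \<rightarrow>\<^sub>M prob_algebra Z"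
    using A V' measurable_cong_sets by blast
  have "emeasure (run_protocol Y \<P> n xs) E = (\<integral>\<^sup>+z. emeasure (?A z) E \<partial>shuffled_view Y \<P> n xs)"
    unfolding run_protocol_def
    by (rule emeasure_bind[OF prob_space.not_empty[OF V'(2)] measurable_prob_algebraD[OF AV] E])
  also have "\<dots> = (\<integral>\<^sup>+w. \<integral>\<^sup>+ms. emeasure (?A (w, ms)) E \<partial>shuffled_reports Y (randomizer \<P> n w) xs \<partial>?P)"
    by (rule nn_integral_shuffled_view[OF P Rx a])
  also have "\<dots> = (\<integral>\<^sup>+w. \<integral>\<^sup>+us. ?s w us \<partial>reports Y (randomizer \<P> n w) xs \<partial>?P)"
  proof (rule nn_integral_cong)
    fix w assume w: "w \<in> space ?P"
    have "randomizer \<P> n w x \<in> space (prob_algebra ?L)" if "x \<in> set xs" for x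
      using measurable_space[OF Rx[OF that] w] .
    from nn_integral_shuffled_reports[OF this aw[OF w]]
    show "(\<integral>\<^sup>+ms. emeasure (?A (w, ms)) E \<partial>shuffled_reports Y (randomizer \<P> n w) xs) =
      (\<integral>\<^sup>+us. ?s w us \<partial>reports Y (randomizer \<P> n w) xs)" by simp
  qed
  finally show "emeasure (run_protocol Y \<P> n xs) E =
    (\<integral>\<^sup>+w. \<integral>\<^sup>+us. ?s w us \<partial>reports Y (randomizer \<P> n w) xs \<partial>?P)" .
next
  let ?P = "public \<P> n" and ?L = "list_space Y"
  have A: "(\<lambda>(w, ms). analyzer \<P> n w ms) \<in> ?P \<Otimes>\<^sub>M ?L \<rightarrow>\<^sub>M prob_algebra Z"
    using \<P> by (auto simp: shuffle_protocol_def)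
  fix w us assume w: "w \<in> space ?P" and us: "us \<in> lists (space Y)"
  interpret prob_space "shuffler Y us" by (rule prob_space_shuffler[OF us])
  have "emeasure (analyzer \<P> n w ms) E \<le> 1" if "ms \<in> space (shuffler Y us)" for ms
  proof -
    have "ms \<in> lists (space Y)" using that sets_eq_imp_space_eq[OF sets_shuffler] by fastforce
    then have "prob_space (analyzer \<P> n w ms)"
      using w measurable_space[OF A, of "(w, ms)"] by (auto simp: space_pair_measure space_prob_algebra)
    then show ?thesis by (rule prob_space.emeasure_le_1)
  qed
  then have "(\<integral>\<^sup>+ms. emeasure (analyzer \<P> n w ms) E \<partial>shuffler Y us) \<le> (\<integral>\<^sup>+ms. 1 \<partial>shuffler Y us)"
    by (intro nn_integral_mono)
  also have "\<dots> = 1" by (simp add: emeasure_space_1)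
  finally show "(\<integral>\<^sup>+ms. emeasure (analyzer \<P> n w ms) E \<partial>shuffler Y us) \<le> 1" .
qed

lemma run_protocol_mset:
  assumes \<P>: "shuffle_protocol X Y Z \<P>" and E: "E \<in> sets Z"
    and xs: "xs \<in> lists X" and eq: "mset xs = mset ys"
  shows "measure (run_protocol Y \<P> n xs) E = measure (run_protocol Y \<P> n ys) E"
proof -
  obtain s where s [measurable]: "(\<lambda>(w, ms). s w ms) \<in> borel_measurable (public \<P> n \<Otimes>\<^sub>M list_space Y)"
    and symm: "\<And>w us vs. w \<in> space (public \<P> n) \<Longrightarrow> us \<in> lists (space Y) \<Longrightarrow> mset us = mset vs \<Longrightarrow> s w us = s w vs"
    and run: "\<And>xs. xs \<in> lists X \<Longrightarrow> emeasure (run_protocol Y \<P> n xs) E =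
      (\<integral>\<^sup>+w. \<integral>\<^sup>+us. s w us \<partial>reports Y (randomizer \<P> n w) xs \<partial>public \<P> n)"
    and "\<And>w us. w \<in> space (public \<P> n) \<Longrightarrow> us \<in> lists (space Y) \<Longrightarrow> s w us \<le> 1"
    by (rule emeasure_run_protocol[OF \<P> E, where n=n]) (rule that)
  have ys: "ys \<in> lists X" using xs mset_eq_setD[OF eq] by auto
  have R: "(\<lambda>w. randomizer \<P> n w x) \<in> public \<P> n \<rightarrow>\<^sub>M prob_algebra (list_space Y)" if "x \<in> set xs" for x
    using \<P> xs that by (auto simp: shuffle_protocol_def)
  have "emeasure (run_protocol Y \<P> n xs) E = emeasure (run_protocol Y \<P> n ys) E"
    unfolding run[OF xs] run[OF ys]
  proof (intro nn_integral_cong nn_integral_reports_mset eq symm)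
    fix w assume [measurable]: "w \<in> space (public \<P> n)"
    show "s w \<in> borel_measurable (list_space Y)" by measurable
    show "randomizer \<P> n w z \<in> space (prob_algebra (list_space Y))" if "z \<in> set xs" for z
      using measurable_space[OF R[OF that]] \<open>w \<in> space (public \<P> n)\<close> by blast
  qed auto
  then show ?thesis by (simp add: measure_def)
qed

text \<open>From the public string and the shuffled messages of the users in \<open>us\<close> one
  can simulate the users in \<open>ys\<close>, then the shuffler and the analyzer. The simulation
  \<open>\<phi>\<close> may depend on \<open>ys\<close> and \<open>E\<close> but not on
  \<open>us\<close>. It uses the public string, which the randomizers of \<open>ys\<close> share and
  which is part of the view.\<close>

lemma run_protocol_append:
  assumes \<P>: "shuffle_protocol X Y Z \<P>" and E: "E \<in> sets Z" and ys: "ys \<in> lists X"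
  obtains \<phi> :: "_ \<Rightarrow> real" where "\<phi> \<in> borel_measurable (public \<P> n \<Otimes>\<^sub>M list_space Y)"
    and "\<And>z. 0 \<le> \<phi> z" "\<And>z. \<phi> z \<le> 1"
    and "\<And>us. us \<in> lists X \<Longrightarrow> measure (run_protocol Y \<P> n (us @ ys)) E = (\<integral>z. \<phi> z \<partial>shuffled_view Y \<P> n us)"
proof -
  let ?P = "public \<P> n" and ?L = "list_space Y"
  obtain s where s [measurable]: "(\<lambda>(w, ms). s w ms) \<in> borel_measurable (?P \<Otimes>\<^sub>M ?L)"
    and symm: "\<And>w us vs. w \<in> space ?P \<Longrightarrow> us \<in> lists (space Y) \<Longrightarrow> mset us = mset vs \<Longrightarrow> s w us = s w vs"
    and run: "\<And>xs. xs \<in> lists X \<Longrightarrow> emeasure (run_protocol Y \<P> n xs) E =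
      (\<integral>\<^sup>+w. \<integral>\<^sup>+us. s w us \<partial>reports Y (randomizer \<P> n w) xs \<partial>?P)"
    and le1: "\<And>w us. w \<in> space ?P \<Longrightarrow> us \<in> lists (space Y) \<Longrightarrow> s w us \<le> 1"
    by (rule emeasure_run_protocol[OF \<P> E, where n=n]) (rule that)
  have P: "prob_space ?P"
    and RX: "\<And>x. x \<in> X \<Longrightarrow> (\<lambda>w. randomizer \<P> n w x) \<in> ?P \<rightarrow>\<^sub>M prob_algebra ?L"
    using \<P> by (auto simp: shuffle_protocol_def)
  have R: "(\<lambda>w. randomizer \<P> n w x) \<in> ?P \<rightarrow>\<^sub>M prob_algebra ?L" if "x \<in> set ys" for x
    using RX ys that by auto
  define \<psi> where "\<psi> = (\<lambda>(w, us). \<integral>\<^sup>+vs. s w (us @ vs) \<partial>reports Y (randomizer \<P> n w) ys)"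
  have rep: "(\<lambda>w. reports Y (randomizer \<P> n w) ys) \<in> ?P \<rightarrow>\<^sub>M prob_algebra ?L"
    by (rule measurable_reports[OF R])
  have [measurable]: "(\<lambda>w. reports Y (randomizer \<P> n w) ys) \<in> ?P \<rightarrow>\<^sub>M subprob_algebra ?L"
    by (rule measurable_prob_algebraD[OF rep])
  have "(\<lambda>(z, vs). s (fst z) (snd z @ vs)) \<in> borel_measurable ((?P \<Otimes>\<^sub>M ?L) \<Otimes>\<^sub>M ?L)" by measurable
  then have "(\<lambda>z. \<integral>\<^sup>+vs. s (fst z) (snd z @ vs) \<partial>reports Y (randomizer \<P> n (fst z)) ys) \<in> borel_measurable (?P \<Otimes>\<^sub>M ?L)"
    by (rule nn_integral_measurable_subprob_algebra2) measurable
  then have \<psi> [measurable]: "\<psi> \<in> borel_measurable (?P \<Otimes>\<^sub>M ?L)" by (simp add: \<psi>_def case_prod_beta)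
  have \<psi>1: "\<psi> z \<le> 1" if "z \<in> space (?P \<Otimes>\<^sub>M ?L)" for z
  proof -
    obtain w us where "z = (w, us)" by (cases z)
    with that have z: "z = (w, us)" "w \<in> space ?P" "us \<in> lists (space Y)"
      by (simp_all add: space_pair_measure)
    have rp: "reports Y (randomizer \<P> n w) ys \<in> space (prob_algebra ?L)" using measurable_space[OF rep z(2)] .
    then interpret prob_space "reports Y (randomizer \<P> n w) ys" by (simp add: space_prob_algebra)
    have "sets (reports Y (randomizer \<P> n w) ys) = sets ?L" using rp by (simp add: space_prob_algebra)
    from sets_eq_imp_space_eq[OF this]
    have "\<psi> z \<le> (\<integral>\<^sup>+vs. 1 \<partial>reports Y (randomizer \<P> n w) ys)"
      unfolding \<psi>_def z(1) prod.case by (intro nn_integral_mono le1) (use z in auto)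
    then show ?thesis by (simp add: emeasure_space_1)
  qed
  \<comment> \<open>\<open>\<psi>\<close> is bounded by 1 only on the underlying space; truncation
    gives a real function with values in [0,1] everywhere, equal to \<open>\<psi>\<close> where it
    matters.\<close>
  define \<phi> where "\<phi> z = min 1 (enn2real (\<psi> z))" for z
  show ?thesis
  proof
    show \<phi>m [measurable]: "\<phi> \<in> borel_measurable (?P \<Otimes>\<^sub>M ?L)" unfolding \<phi>_def by measurable
    show \<phi>0: "0 \<le> \<phi> z" for z by (simp add: \<phi>_def)
    show "\<phi> z \<le> 1" for z by (simp add: \<phi>_def)
    fix us assume us: "us \<in> lists X"
    have Rus: "(\<lambda>w. randomizer \<P> n w x) \<in> ?P \<rightarrow>\<^sub>M prob_algebra ?L" if "x \<in> set us" for x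
      using RX us that by auto
    have V: "shuffled_view Y \<P> n us \<in> space (prob_algebra (?P \<Otimes>\<^sub>M ?L))"
      by (rule shuffled_view_in_prob_algebra[OF P Rus])
    then have sV: "sets (shuffled_view Y \<P> n us) = sets (?P \<Otimes>\<^sub>M ?L)"
      by (simp add: space_prob_algebra)
    have "emeasure (run_protocol Y \<P> n (us @ ys)) E =
      (\<integral>\<^sup>+w. \<integral>\<^sup>+ms. s w ms \<partial>reports Y (randomizer \<P> n w) (us @ ys) \<partial>?P)"
      using us ys by (intro run) simp
    also have "\<dots> = (\<integral>\<^sup>+w. \<integral>\<^sup>+ms. \<psi> (w, ms) \<partial>shuffled_reports Y (randomizer \<P> n w) us \<partial>?P)"
    proof (rule nn_integral_cong)
      fix w assume w [measurable]: "w \<in> space ?P"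
      have Rw: "randomizer \<P> n w x \<in> space (prob_algebra ?L)" if "x \<in> set us \<union> set ys" for x
        using measurable_space[OF RX w, of x] that us ys by auto
      have "(\<integral>\<^sup>+ms. s w ms \<partial>reports Y (randomizer \<P> n w) (us @ ys)) =
        (\<integral>\<^sup>+ms. \<psi> (w, ms) \<partial>reports Y (randomizer \<P> n w) us)"
        unfolding \<psi>_def prod.case by (rule nn_integral_reports_append[OF Rw]) measurable
      also have "\<dots> = (\<integral>\<^sup>+ms. \<psi> (w, ms) \<partial>shuffled_reports Y (randomizer \<P> n w) us)"
      proof (rule nn_integral_shuffled_reports_symmetric[symmetric])
        fix us' vs' :: "'b list" assume uv: "us' \<in> lists (space Y)" "mset us' = mset vs'"
        have "sets (reports Y (randomizer \<P> n w) ys) = sets ?L"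
          using measurable_space[OF rep w] by (simp add: space_prob_algebra)
        from sets_eq_imp_space_eq[OF this] show "\<psi> (w, us') = \<psi> (w, vs')"
          unfolding \<psi>_def prod.case by (intro nn_integral_cong symm w) (use uv in auto)
      qed (use Rw in auto)
      finally show "(\<integral>\<^sup>+ms. s w ms \<partial>reports Y (randomizer \<P> n w) (us @ ys)) =
         (\<integral>\<^sup>+ms. \<psi> (w, ms) \<partial>shuffled_reports Y (randomizer \<P> n w) us)" .
    qed
    also have "\<dots> = (\<integral>\<^sup>+z. \<psi> z \<partial>shuffled_view Y \<P> n us)"
      by (rule nn_integral_shuffled_view[OF P Rus \<psi>, symmetric])
    also have "\<dots> = (\<integral>\<^sup>+z. ennreal (\<phi> z) \<partial>shuffled_view Y \<P> n us)"
    proof (rule nn_integral_cong)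
      fix z assume "z \<in> space (shuffled_view Y \<P> n us)"
      then have "\<psi> z \<le> 1" using \<psi>1 sets_eq_imp_space_eq[OF sV] by simp
      then show "\<psi> z = ennreal (\<phi> z)"
        unfolding \<phi>_def by (cases "\<psi> z") (auto simp: min_def top_unique)
    qed
    finally have "emeasure (run_protocol Y \<P> n (us @ ys)) E = (\<integral>\<^sup>+z. ennreal (\<phi> z) \<partial>shuffled_view Y \<P> n us)" .
    moreover have "(\<integral>z. \<phi> z \<partial>shuffled_view Y \<P> n us) = enn2real (\<integral>\<^sup>+z. ennreal (\<phi> z) \<partial>shuffled_view Y \<P> n us)"
      by (rule integral_eq_nn_integral) (simp_all add: \<phi>0 \<phi>m measurable_cong_sets[OF sV refl])
    ultimately show "measure (run_protocol Y \<P> n (us @ ys)) E = (\<integral>z. \<phi> z \<partial>shuffled_view Y \<P> n us)"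
      by (simp add: measure_def)
  qed
qed

subsection \<open>Correlation of private kernels with orthogonal functions\<close>

text \<open>Expands the squared norm of \<open>N * g - (\<Sum>l\<in>L. c l * \<psi> l)\<close>,
  which is N times the distance vector from \<open>g\<close> to its projection on the span of the
  \<open>\<psi> l\<close>. The factor N avoids divisions, as the \<open>\<psi> l\<close> have
  squared norm N = \<open>card X\<close>.\<close>

lemma bessel_inequality_sum:
  fixes g :: "'x \<Rightarrow> real"
  assumes fin: "finite X" "finite L"
    and orth: "\<And>l l'. l \<in> L \<Longrightarrow> l' \<in> L \<Longrightarrow> (\<Sum>x\<in>X. \<psi> l x * \<psi> l' x) = (if l = l' then real (card X) else 0)"
  shows "(\<Sum>l\<in>L. (\<Sum>x\<in>X. \<psi> l x * g x)\<^sup>2) \<le> real (card X) * (\<Sum>x\<in>X. (g x)\<^sup>2)"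
proof (cases "X = {}")
  case False
  define N where "N = real (card X)"
  define c where "c l = (\<Sum>x\<in>X. \<psi> l x * g x)" for l
  have N: "N > 0" using False fin by (simp add: N_def card_gt_0_iff)
  have cross: "(\<Sum>x\<in>X. g x * (\<Sum>l\<in>L. c l * \<psi> l x)) = (\<Sum>l\<in>L. (c l)\<^sup>2)"
  proof -
    have "(\<Sum>x\<in>X. g x * (\<Sum>l\<in>L. c l * \<psi> l x)) = (\<Sum>l\<in>L. \<Sum>x\<in>X. c l * (\<psi> l x * g x))"
      unfolding sum_distrib_left by (subst sum.swap) (simp add: mult_ac)
    also have "\<dots> = (\<Sum>l\<in>L. (c l)\<^sup>2)"
      by (simp add: c_def power2_eq_square flip: sum_distrib_left)
    finally show ?thesis .
  qed
  have sq: "(\<Sum>x\<in>X. (\<Sum>l\<in>L. c l * \<psi> l x)\<^sup>2) = N * (\<Sum>l\<in>L. (c l)\<^sup>2)"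
  proof -
    have "(\<Sum>x\<in>X. (\<Sum>l\<in>L. c l * \<psi> l x)\<^sup>2) = (\<Sum>x\<in>X. \<Sum>l\<in>L. \<Sum>l'\<in>L. c l * c l' * (\<psi> l x * \<psi> l' x))"
      by (simp add: power2_eq_square sum_product mult_ac)
    also have "\<dots> = (\<Sum>l\<in>L. \<Sum>l'\<in>L. \<Sum>x\<in>X. c l * c l' * (\<psi> l x * \<psi> l' x))"
      by (subst sum.swap) (intro sum.cong refl sum.swap)
    also have "\<dots> = (\<Sum>l\<in>L. \<Sum>l'\<in>L. c l * c l' * (if l = l' then N else 0))"
      unfolding sum_distrib_left[symmetric] N_def by (intro sum.cong refl) (simp add: orth)
    also have "\<dots> = (\<Sum>l\<in>L. N * (c l)\<^sup>2)"
      using fin by (simp add: if_distrib power2_eq_square mult_ac cong: if_cong)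
    finally show ?thesis by (simp add: sum_distrib_left)
  qed
  have "0 \<le> (\<Sum>x\<in>X. (N * g x - (\<Sum>l\<in>L. c l * \<psi> l x))\<^sup>2)" by (simp add: sum_nonneg)
  also have "\<dots> = N\<^sup>2 * (\<Sum>x\<in>X. (g x)\<^sup>2) - 2 * N * (\<Sum>x\<in>X. g x * (\<Sum>l\<in>L. c l * \<psi> l x))
      + (\<Sum>x\<in>X. (\<Sum>l\<in>L. c l * \<psi> l x)\<^sup>2)"
    by (simp add: power2_diff sum.distrib sum_subtractf power_mult_distrib sum_distrib_left mult_ac)
  also have "\<dots> = N * (N * (\<Sum>x\<in>X. (g x)\<^sup>2) - (\<Sum>l\<in>L. (c l)\<^sup>2))"
    unfolding cross sq by (simp add: algebra_simps power2_eq_square)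
  finally show ?thesis using N by (simp add: zero_le_mult_iff N_def c_def)
qed (use fin in simp)

section \<open>Densities under approximate privacy\<close>

lemma ex_real_density:
  assumes "prob_space \<mu>" "prob_space \<nu>" "sets \<nu> = sets \<mu>" "absolutely_continuous \<mu> \<nu>"
  shows "\<exists>D :: _ \<Rightarrow> real. D \<in> borel_measurable \<mu> \<and> (\<forall>z. 0 \<le> D z) \<and> \<nu> = density \<mu> (\<lambda>z. ennreal (D z))"
proof -
  interpret \<mu>: prob_space \<mu> by fact
  interpret \<nu>: prob_space \<nu> by fact
  obtain D where D: "D \<in> borel_measurable \<mu>" "AE z in \<mu>. RN_deriv \<mu> \<nu> z = ennreal (D z)" "\<And>z. 0 \<le> D z"
    using \<mu>.real_RN_deriv[OF \<nu>.finite_measure_axioms assms(4,3)] by metis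
  have "\<nu> = density \<mu> (RN_deriv \<mu> \<nu>)" using \<mu>.density_RN_deriv assms by metis
  also have "\<dots> = density \<mu> (\<lambda>z. ennreal (D z))" using D by (intro density_cong) auto
  finally show ?thesis using D by blast
qed

text \<open>The clipping error lives on the events D > a and D < 1/a. On the first it integrates to
  nu(A) - a mu(A), at most \<delta> by \<open>up\<close>; on the second to mu(B)/a - nu(B), at most
  \<delta>/a by \<open>lo\<close>.\<close>

lemma density_close_to_clipped:
  assumes \<mu>: "prob_space \<mu>" and \<nu>: "prob_space (density \<mu> (\<lambda>z. ennreal (D z)))"
    and D [measurable]: "D \<in> borel_measurable \<mu>" and D0: "\<And>z. 0 \<le> D z" and a: "1 \<le> (a::real)"
    and up: "\<And>E. E \<in> sets \<mu> \<Longrightarrow> measure (density \<mu> (\<lambda>z. ennreal (D z))) E \<le> a * measure \<mu> E + \<delta>"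
    and lo: "\<And>E. E \<in> sets \<mu> \<Longrightarrow> measure \<mu> E \<le> a * measure (density \<mu> (\<lambda>z. ennreal (D z))) E + \<delta>"
  shows "integrable \<mu> D" and "(\<integral>z. \<bar>D z - max (1 / a) (min a (D z))\<bar> \<partial>\<mu>) \<le> 2 * \<delta>"
proof -
  interpret \<mu>: prob_space \<mu> by fact
  let ?\<nu> = "density \<mu> (\<lambda>z. ennreal (D z))"
  interpret \<nu>: prob_space ?\<nu> by fact
  have "integrable ?\<nu> (\<lambda>_. 1 :: real)" by simp
  then show intD [simp]: "integrable \<mu> D"
    by (subst (asm) integrable_density) (use D0 in auto)
  have m\<nu>: "measure ?\<nu> E = (\<integral>z. D z * indicator E z \<partial>\<mu>)" if "E \<in> sets \<mu>" for E
  proof -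
    have "measure ?\<nu> E = (\<integral>z. indicator E z \<partial>?\<nu>)"
      using that sets.sets_into_space[OF that] by (simp add: Int_absorb2)
    also have "\<dots> = (\<integral>z. D z * indicator E z \<partial>\<mu>)"
      using that D0 by (subst integral_density) auto
    finally show ?thesis .
  qed
  have m\<mu>: "measure \<mu> E = (\<integral>z. indicator E z \<partial>\<mu>)" if "E \<in> sets \<mu>" for E
    using that sets.sets_into_space[OF that] by (simp add: Int_absorb2)
  define A where "A = {z \<in> space \<mu>. a < D z}"
  define B where "B = {z \<in> space \<mu>. D z < 1 / a}"
  have [measurable]: "A \<in> sets \<mu>" "B \<in> sets \<mu>" unfolding A_def B_def by measurable
  have int [simp]: "integrable \<mu> (\<lambda>z. D z * indicator E z)" "integrable \<mu> (indicator E :: _ \<Rightarrow> real)" if "E \<in> sets \<mu>" for E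
    using that integrable_mult_indicator[OF that intD] by (auto simp: mult.commute \<mu>.emeasure_eq_measure)
  have "(\<integral>z. \<bar>D z - max (1 / a) (min a (D z))\<bar> \<partial>\<mu>) =
    (\<integral>z. (D z * indicator A z - a * indicator A z) + (1 / a * indicator B z - D z * indicator B z) \<partial>\<mu>)"
  proof (rule Bochner_Integration.integral_cong[OF refl])
    fix z assume z: "z \<in> space \<mu>"
    have "1 / a \<le> 1" using a by simp
    then have "1 / a \<le> a" using a by linarith
    then show "\<bar>D z - max (1 / a) (min a (D z))\<bar> =
      (D z * indicator A z - a * indicator A z) + (1 / a * indicator B z - D z * indicator B z)"
      using z by (auto simp: A_def B_def indicator_def max_def min_def)
  qed
  also have "\<dots> = (measure ?\<nu> A - a * measure \<mu> A) + (1 / a * measure \<mu> B - measure ?\<nu> B)"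
    by (simp add: m\<nu> m\<mu> del: Bochner_Integration.integral_indicator)
  also have "\<dots> \<le> \<delta> + \<delta>"
  proof (rule add_mono)
    show "measure ?\<nu> A - a * measure \<mu> A \<le> \<delta>" using up[of A] by simp
    have "0 \<le> \<delta>" using lo[of "{}"] by simp
    then have "\<delta> / a \<le> \<delta>" using a by (simp add: divide_le_eq mult_le_cancel_left1)
    moreover have "measure \<mu> B / a \<le> measure ?\<nu> B + \<delta> / a"
      using lo[of B] a by (simp add: field_simps)
    ultimately show "1 / a * measure \<mu> B - measure ?\<nu> B \<le> \<delta>" by simp
  qed
  finally show "(\<integral>z. \<bar>D z - max (1 / a) (min a (D z))\<bar> \<partial>\<mu>) \<le> 2 * \<delta>" by simp
qed

text \<open>The kernel \<open>M\<close> is common to all \<open>l\<close>, while the test functions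
  \<open>\<phi> l\<close> may differ. So for each fixed outcome z the clipped density, as a function
  of the row x, can be paired with all \<open>\<psi> l\<close> at once, and Bessel's inequality
  applies pointwise in z.\<close>

lemma dp_correlation_bound:
  fixes M :: "'x \<Rightarrow> 'z measure" and \<psi> :: "'l \<Rightarrow> 'x \<Rightarrow> real" and \<phi> :: "'l \<Rightarrow> 'z \<Rightarrow> real"
  assumes X: "finite X" "X \<noteq> {}" and L: "finite L"
    and M: "\<And>x. x \<in> X \<Longrightarrow> M x \<in> space (prob_algebra Z)"
    and dp: "\<And>x y E. x \<in> X \<Longrightarrow> y \<in> X \<Longrightarrow> E \<in> sets Z \<Longrightarrow> measure (M x) E \<le> a * measure (M y) E + \<delta>"
    and a: "1 \<le> a"
    and orth: "\<And>l l'. l \<in> L \<Longrightarrow> l' \<in> L \<Longrightarrow> (\<Sum>x\<in>X. \<psi> l x * \<psi> l' x) = (if l = l' then real (card X) else 0)"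
    and mean0: "\<And>l. l \<in> L \<Longrightarrow> (\<Sum>x\<in>X. \<psi> l x) = 0"
    and \<psi>1: "\<And>l x. l \<in> L \<Longrightarrow> x \<in> X \<Longrightarrow> \<bar>\<psi> l x\<bar> \<le> 1"
    and \<phi>: "\<And>l. l \<in> L \<Longrightarrow> \<phi> l \<in> borel_measurable Z"
    and \<phi>1: "\<And>l z. l \<in> L \<Longrightarrow> \<bar>\<phi> l z\<bar> \<le> 1"
  shows "(\<Sum>l\<in>L. \<Sum>x\<in>X. \<psi> l x * (\<integral>z. \<phi> l z \<partial>M x))
    \<le> real (card X) * (sqrt (real (card L)) * (a - 1) + 2 * \<delta> * real (card L))"
proof -
  define N where "N = real (card X)"
  have N: "N > 0" using X by (simp add: N_def card_gt_0_iff)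
  \<comment> \<open>The average of the kernels serves as the reference measure: it dominates every
    \<open>M x\<close>, and the privacy inequalities survive averaging over one of the two rows, in
    both directions.\<close>
  define \<mu> where "\<mu> = uniform_count_measure X \<bind> M"
  interpret U: prob_space "uniform_count_measure X" by (rule prob_space_uniform_count_measure[OF X])
  have Mm: "M \<in> uniform_count_measure X \<rightarrow>\<^sub>M prob_algebra Z"
    using M by (auto simp: measurable_def space_uniform_count_measure sets_uniform_count_measure)
  have MP: "prob_space (M x)" and MS: "sets (M x) = sets Z" if "x \<in> X" for x
    using M[OF that] by (auto simp: space_prob_algebra)
  have \<mu>P: "prob_space \<mu>" and \<mu>S: "sets \<mu> = sets Z"
    unfolding \<mu>_def using U.prob_space_axioms Mm
    by (auto intro!: prob_space_bind'[of _ "uniform_count_measure X"] sets_bind'[of _ "uniform_count_measure X"]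
        simp: space_prob_algebra)
  interpret \<mu>: prob_space \<mu> by (rule \<mu>P)
  have m\<mu>: "measure \<mu> E = (\<Sum>x\<in>X. measure (M x) E) / N" if "E \<in> sets Z" for E
    unfolding \<mu>_def U.measure_bind[OF measurable_prob_algebraD[OF Mm] that] N_def
    by (rule integral_uniform_count_measure[OF X(1)])
  have up: "measure (M x) E \<le> a * measure \<mu> E + \<delta>" if "x \<in> X" "E \<in> sets Z" for x E
  proof -
    have "N * measure (M x) E = (\<Sum>y\<in>X. measure (M x) E)" by (simp add: N_def)
    also have "\<dots> \<le> (\<Sum>y\<in>X. a * measure (M y) E + \<delta>)" using that by (intro sum_mono dp)
    also have "\<dots> = N * (a * measure \<mu> E + \<delta>)"
      using N that by (simp add: m\<mu> sum.distrib field_simps N_def flip: sum_distrib_left)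
    finally show ?thesis using N by simp
  qed
  have lo: "measure \<mu> E \<le> a * measure (M x) E + \<delta>" if "x \<in> X" "E \<in> sets Z" for x E
  proof -
    have "N * measure \<mu> E = (\<Sum>y\<in>X. measure (M y) E)" using N that by (simp add: m\<mu>)
    also have "\<dots> \<le> (\<Sum>y\<in>X. a * measure (M x) E + \<delta>)" using that by (intro sum_mono dp)
    also have "\<dots> = N * (a * measure (M x) E + \<delta>)" by (simp add: N_def)
    finally show ?thesis using N by simp
  qed
  have "absolutely_continuous \<mu> (M x)" if x: "x \<in> X" for x
    unfolding absolutely_continuous_def
  proof
    fix E assume "E \<in> null_sets \<mu>"
    then have E: "E \<in> sets Z" "measure \<mu> E = 0" using \<mu>S by (auto simp: null_sets_def measure_def)
    then have "(\<Sum>y\<in>X. measure (M y) E) = 0" using N m\<mu>[of E] by simp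
    then have "measure (M x) E = 0" using x X by (subst (asm) sum_nonneg_eq_0_iff) auto
    then show "E \<in> null_sets (M x)"
      using E MS[OF x] prob_space.finite_measure[OF MP[OF x], THEN finite_measure.emeasure_eq_measure]
      by (auto simp: null_sets_def)
  qed
  then have "\<exists>D :: 'z \<Rightarrow> real. D \<in> borel_measurable \<mu> \<and> (\<forall>z. 0 \<le> D z) \<and> M x = density \<mu> (\<lambda>z. ennreal (D z))"
    if "x \<in> X" for x
    using that MP MS \<mu>S \<mu>P by (intro ex_real_density) auto
  then obtain D :: "'x \<Rightarrow> 'z \<Rightarrow> real" where D: "\<And>x. x \<in> X \<Longrightarrow> D x \<in> borel_measurable \<mu>"
    "\<And>x z. x \<in> X \<Longrightarrow> 0 \<le> D x z" "\<And>x. x \<in> X \<Longrightarrow> M x = density \<mu> (\<lambda>z. ennreal (D x z))"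
    by metis
  define G where "G x z = max (1 / a) (min a (D x z))" for x z
  have Dint: "integrable \<mu> (D x)" and DG: "(\<integral>z. \<bar>D x z - G x z\<bar> \<partial>\<mu>) \<le> 2 * \<delta>" if x: "x \<in> X" for x
    using density_close_to_clipped[OF \<mu>P _ D(1)[OF x] D(2)[OF x] a, of \<delta>] MP[OF x] up[OF x] lo[OF x] \<mu>S D(3)[OF x]
    unfolding G_def by auto
  have Gm: "G x \<in> borel_measurable \<mu>" if "x \<in> X" for x using D(1)[OF that] unfolding G_def by measurable
  have G1: "\<bar>G x z - 1\<bar> \<le> a - 1" for x z
  proof -
    \<comment> \<open>The lower clip satisfies 1 - 1/a \<le> a - 1, which is (a - 1)^2 \<ge> 0
      divided by a.\<close>
    have "1 \<le> a * a" using mult_mono[of 1 a 1 a] a by simp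
    moreover have "0 \<le> (a - 1)\<^sup>2" by simp
    ultimately have "2 - a \<le> 1 / a" "1 / a \<le> a" "1 / a \<le> 1"
      using a by (auto simp: field_simps power2_eq_square)
    then show ?thesis using a by (auto simp: G_def max_def min_def abs_if)
  qed
  have Gint: "integrable \<mu> (G x)" if "x \<in> X" for x
  proof (rule \<mu>.integrable_const_bound[of _ a])
    show "AE z in \<mu>. norm (G x z) \<le> a"
    proof (rule AE_I2)
      fix z show "norm (G x z) \<le> a" using G1[of x z] a by (auto simp: G_def max_def min_def)
    qed
  qed (rule Gm[OF that])
  have \<phi>m: "\<phi> l \<in> borel_measurable \<mu>" if "l \<in> L" for l
    using \<phi>[OF that] measurable_cong_sets[OF \<mu>S refl] by blast
  have bint: "integrable \<mu> (\<lambda>z. f z * \<phi> l z)" if "integrable \<mu> f" "l \<in> L" for f l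
  proof (rule Bochner_Integration.integrable_bound[OF that(1)])
    show "(\<lambda>z. f z * \<phi> l z) \<in> borel_measurable \<mu>"
      using that \<phi>m by (intro borel_measurable_times) auto
    show "AE z in \<mu>. norm (f z * \<phi> l z) \<le> norm (f z)"
      using \<phi>1[OF that(2)] by (intro AE_I2) (simp add: abs_mult mult_left_le)
  qed
  have \<phi>int: "integrable \<mu> (\<phi> l)" if "l \<in> L" for l
    using bint[of "\<lambda>_. 1" l] that by simp
  \<comment> \<open>The density is written as 1 + (G - 1) + (D - G). The constant part does not
    depend on x and is killed by \<open>mean0\<close>, the middle part goes to Bessel, and the last
    part has mass at most 2\<delta>.\<close>
  have split: "(\<integral>z. \<phi> l z \<partial>M x) =
      (\<integral>z. \<phi> l z \<partial>\<mu>) + ((\<integral>z. (G x z - 1) * \<phi> l z \<partial>\<mu>) + (\<integral>z. (D x z - G x z) * \<phi> l z \<partial>\<mu>))"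
    if "x \<in> X" "l \<in> L" for x l
  proof -
    have "(\<integral>z. \<phi> l z \<partial>M x) = (\<integral>z. D x z * \<phi> l z \<partial>\<mu>)"
      unfolding D(3)[OF that(1)] using D(1,2) that \<phi>m by (subst integral_density) auto
    also have "\<dots> = (\<integral>z. \<phi> l z + ((G x z - 1) * \<phi> l z + (D x z - G x z) * \<phi> l z) \<partial>\<mu>)"
      by (simp add: algebra_simps)
    also have "\<dots> = (\<integral>z. \<phi> l z \<partial>\<mu>) + ((\<integral>z. (G x z - 1) * \<phi> l z \<partial>\<mu>) + (\<integral>z. (D x z - G x z) * \<phi> l z \<partial>\<mu>))"
      using \<phi>int[OF that(2)] bint[OF Bochner_Integration.integrable_diff[OF Gint[OF that(1)] \<mu>.integrable_const[of 1]] that(2)]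
        bint[OF Bochner_Integration.integrable_diff[OF Dint[OF that(1)] Gint[OF that(1)]] that(2)]
      by simp
    finally show ?thesis .
  qed
  have small: "\<psi> l x * (\<integral>z. (D x z - G x z) * \<phi> l z \<partial>\<mu>) \<le> 2 * \<delta>" if "x \<in> X" "l \<in> L" for x l
  proof -
    have "\<bar>\<integral>z. (D x z - G x z) * \<phi> l z \<partial>\<mu>\<bar> \<le> (\<integral>z. \<bar>(D x z - G x z) * \<phi> l z\<bar> \<partial>\<mu>)"
      by (rule integral_abs_bound)
    also have "\<dots> \<le> (\<integral>z. \<bar>D x z - G x z\<bar> \<partial>\<mu>)"
      using that Dint Gint \<phi>1 integrable_abs[OF bint[of "\<lambda>z. D x z - G x z" l]]
      by (intro integral_mono) (auto simp: abs_mult mult_left_le)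
    also have "\<dots> \<le> 2 * \<delta>" by (rule DG[OF that(1)])
    finally have i: "\<bar>\<integral>z. (D x z - G x z) * \<phi> l z \<partial>\<mu>\<bar> \<le> 2 * \<delta>" .
    have "\<psi> l x * (\<integral>z. (D x z - G x z) * \<phi> l z \<partial>\<mu>) \<le> \<bar>\<psi> l x\<bar> * \<bar>\<integral>z. (D x z - G x z) * \<phi> l z \<partial>\<mu>\<bar>"
      by (simp flip: abs_mult)
    also have "\<dots> \<le> 1 * (2 * \<delta>)" using \<psi>1[OF that(2,1)] i by (intro mult_mono) auto
    finally show ?thesis by simp
  qed
  \<comment> \<open>Cauchy-Schwarz over \<open>L\<close> contributes the square root of
    \<open>card L\<close>; Bessel bounds the norm of the coefficients by N (a - 1), since every
    value of \<open>G x z - 1\<close> is at most a - 1 in modulus.\<close>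
  have point: "(\<Sum>l\<in>L. \<Sum>x\<in>X. \<psi> l x * ((G x z - 1) * \<phi> l z)) \<le> N * (sqrt (real (card L)) * (a - 1))" for z
  proof -
    define c where "c l = (\<Sum>x\<in>X. \<psi> l x * (G x z - 1))" for l
    have "(\<Sum>l\<in>L. \<Sum>x\<in>X. \<psi> l x * ((G x z - 1) * \<phi> l z)) = (\<Sum>l\<in>L. \<phi> l z * c l)"
      unfolding c_def sum_distrib_left by (simp add: mult_ac)
    also have "\<dots> \<le> (\<Sum>l\<in>L. \<bar>1\<bar> * \<bar>c l\<bar>)"
    proof (rule sum_mono)
      fix l assume "l \<in> L"
      have "\<phi> l z * c l \<le> \<bar>\<phi> l z\<bar> * \<bar>c l\<bar>" by (simp flip: abs_mult)
      also have "\<dots> \<le> \<bar>1\<bar> * \<bar>c l\<bar>" using \<phi>1[OF \<open>l \<in> L\<close>] by (intro mult_right_mono) auto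
      finally show "\<phi> l z * c l \<le> \<bar>1\<bar> * \<bar>c l\<bar>" .
    qed
    also have "\<dots> \<le> L2_set (\<lambda>_. 1) L * L2_set c L" by (rule L2_set_mult_ineq)
    also have "\<dots> \<le> sqrt (real (card L)) * (N * (a - 1))"
    proof -
      have "(\<Sum>l\<in>L. (c l)\<^sup>2) \<le> N * (\<Sum>x\<in>X. (G x z - 1)\<^sup>2)"
        unfolding c_def N_def by (rule bessel_inequality_sum[OF X(1) L orth])
      also have "\<dots> \<le> N * (\<Sum>x\<in>X. (a - 1)\<^sup>2)"
        using N a G1 by (intro mult_left_mono sum_mono) (auto intro!: abs_le_square_iff[THEN iffD1])
      also have "\<dots> = (N * (a - 1))\<^sup>2" by (simp add: N_def power_mult_distrib power2_eq_square)
      finally have "sqrt (\<Sum>l\<in>L. (c l)\<^sup>2) \<le> N * (a - 1)" using N a by (intro real_le_lsqrt) auto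
      then show ?thesis unfolding L2_set_def by (intro mult_mono) (auto intro: sum_nonneg)
    qed
    finally show ?thesis by (simp add: mult_ac)
  qed
  have main: "(\<Sum>l\<in>L. \<Sum>x\<in>X. \<psi> l x * (\<integral>z. (G x z - 1) * \<phi> l z \<partial>\<mu>)) \<le> N * (sqrt (real (card L)) * (a - 1))"
  proof -
    have gi: "integrable \<mu> (\<lambda>z. \<psi> l x * ((G x z - 1) * \<phi> l z))" if "x \<in> X" "l \<in> L" for x l
      using that Gint by (intro integrable_mult_right bint) auto
    have "(\<Sum>l\<in>L. \<Sum>x\<in>X. \<psi> l x * (\<integral>z. (G x z - 1) * \<phi> l z \<partial>\<mu>)) =
      (\<integral>z. (\<Sum>l\<in>L. \<Sum>x\<in>X. \<psi> l x * ((G x z - 1) * \<phi> l z)) \<partial>\<mu>)"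
      using gi by (simp add: Bochner_Integration.integral_sum Bochner_Integration.integrable_sum
          del: integral_mult_right_zero flip: integral_mult_right_zero)
    also have "\<dots> \<le> (\<integral>z. N * (sqrt (real (card L)) * (a - 1)) \<partial>\<mu>)"
      using gi by (intro integral_mono point Bochner_Integration.integrable_sum) auto
    finally show ?thesis by (simp add: \<mu>.prob_space)
  qed
  have "(\<Sum>l\<in>L. \<Sum>x\<in>X. \<psi> l x * (\<integral>z. \<phi> l z \<partial>M x)) =
    (\<Sum>l\<in>L. (\<Sum>x\<in>X. \<psi> l x) * (\<integral>z. \<phi> l z \<partial>\<mu>)) +
    ((\<Sum>l\<in>L. \<Sum>x\<in>X. \<psi> l x * (\<integral>z. (G x z - 1) * \<phi> l z \<partial>\<mu>)) +
     (\<Sum>l\<in>L. \<Sum>x\<in>X. \<psi> l x * (\<integral>z. (D x z - G x z) * \<phi> l z \<partial>\<mu>)))"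
    by (simp add: split sum.distrib distrib_left sum_distrib_right)
  also have "\<dots> \<le> 0 + (N * (sqrt (real (card L)) * (a - 1)) + (\<Sum>l\<in>L. \<Sum>x\<in>X. 2 * \<delta>))"
    by (intro add_mono main sum_mono small) (auto simp: mean0)
  also have "\<dots> = N * (sqrt (real (card L)) * (a - 1) + 2 * \<delta> * real (card L))"
    by (simp add: N_def algebra_simps)
  finally show ?thesis unfolding N_def .
qed

subsection \<open>The hybrid argument\<close>

text \<open>The weights may be negative, so that differences of product distributions are of the same form.\<close>

primrec wsum :: "'x set \<Rightarrow> ('x \<Rightarrow> real) list \<Rightarrow> ('x list \<Rightarrow> real) \<Rightarrow> real" where
  "wsum X [] T = T []"
| "wsum X (w # ws) T = (\<Sum>x\<in>X. w x * wsum X ws (\<lambda>xs. T (x # xs)))"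

section \<open>Calculus of signed product sums over finite rows\<close>

lemma wsum_cong:
  assumes "\<And>xs. xs \<in> lists X \<Longrightarrow> length xs = length ws \<Longrightarrow> T xs = T' xs"
  shows "wsum X ws T = wsum X ws T'"
  using assms
proof (induction ws arbitrary: T T')
  case (Cons w ws)
  have "wsum X ws (\<lambda>xs. T (x # xs)) = wsum X ws (\<lambda>xs. T' (x # xs))" if "x \<in> X" for x
    by (rule Cons.IH) (use that Cons.prems in simp)
  then show ?case by simp
qed simp

lemma wsum_append: "wsum X (ws @ ws') T = wsum X ws (\<lambda>xs. wsum X ws' (\<lambda>ys. T (xs @ ys)))"
  by (induction ws arbitrary: T) auto

lemma wsum_sum: "wsum X ws (\<lambda>xs. \<Sum>l\<in>L. T l xs) = (\<Sum>l\<in>L. wsum X ws (T l))"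
proof (induction ws arbitrary: T)
  case (Cons w ws)
  have "wsum X (w # ws) (\<lambda>xs. \<Sum>l\<in>L. T l xs) = (\<Sum>x\<in>X. \<Sum>l\<in>L. w x * wsum X ws (\<lambda>xs. T l (x # xs)))"
    by (simp add: Cons.IH sum_distrib_left)
  also have "\<dots> = (\<Sum>l\<in>L. wsum X (w # ws) (T l))" by (subst sum.swap) simp
  finally show ?case .
qed simp

lemma wsum_cmult: "wsum X ws (\<lambda>xs. c * T xs) = c * wsum X ws T"
  by (induction ws arbitrary: T) (auto simp: sum_distrib_left mult_ac)

lemma wsum_diff: "wsum X ws (\<lambda>xs. T xs - T' xs) = wsum X ws T - wsum X ws T'"
  by (induction ws arbitrary: T T') (auto simp: right_diff_distrib sum_subtractf)

lemma wsum_mono: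
  assumes "\<And>w x. w \<in> set ws \<Longrightarrow> x \<in> X \<Longrightarrow> 0 \<le> w x"
    and "\<And>xs. xs \<in> lists X \<Longrightarrow> length xs = length ws \<Longrightarrow> T xs \<le> T' xs"
  shows "wsum X ws T \<le> wsum X ws T'"
  using assms
proof (induction ws arbitrary: T T')
  case (Cons w ws)
  have "wsum X ws (\<lambda>xs. T (x # xs)) \<le> wsum X ws (\<lambda>xs. T' (x # xs))" if "x \<in> X" for x
    by (rule Cons.IH) (use that Cons.prems in simp_all)
  then show ?case using Cons.prems(1) by (auto intro!: sum_mono mult_left_mono)
qed simp

lemma wsum_const:
  assumes "\<And>w. w \<in> set ws \<Longrightarrow> (\<Sum>x\<in>X. w x) = 1"
  shows "wsum X ws (\<lambda>_. c) = c"
  using assms by (induction ws) (auto simp flip: sum_distrib_right)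

text \<open>Linearity in one coordinate serves two purposes: resolving a mixed user into a uniform
  and a tilted one, and splitting a tilted user into a uniform one and a signed
  perturbation.\<close>

lemma wsum_linear:
  "wsum X (ws @ (\<lambda>x. a * f x + b * g x) # ws') T = a * wsum X (ws @ f # ws') T + b * wsum X (ws @ g # ws') T"
  by (induction ws arbitrary: T) (auto simp: algebra_simps sum.distrib sum_distrib_left)

text \<open>Adjacent coordinates are exchanged by swapping finite sums and using the symmetry of
  \<open>T\<close>; induction carries the weight past all of \<open>ws\<close>.\<close>

lemma wsum_move:
  assumes "\<And>xs ys. xs \<in> lists X \<Longrightarrow> mset xs = mset ys \<Longrightarrow> T xs = T ys"
  shows "wsum X (ws @ w # ws') T = wsum X (w # ws @ ws') T"
  using assms
proof (induction ws arbitrary: T)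
  case (Cons v ws)
  have IH: "wsum X (ws @ w # ws') (\<lambda>xs. T (x # xs)) = wsum X (w # ws @ ws') (\<lambda>xs. T (x # xs))"
    if "x \<in> X" for x using that Cons.prems by (intro Cons.IH) auto
  have "wsum X ((v # ws) @ w # ws') T =
    (\<Sum>x\<in>X. \<Sum>y\<in>X. v x * (w y * wsum X (ws @ ws') (\<lambda>xs. T (x # y # xs))))"
    by (simp add: IH sum_distrib_left)
  also have "\<dots> = (\<Sum>y\<in>X. \<Sum>x\<in>X. w y * (v x * wsum X (ws @ ws') (\<lambda>xs. T (x # y # xs))))"
    by (subst sum.swap) (simp add: mult_ac)
  also have "\<dots> = (\<Sum>y\<in>X. \<Sum>x\<in>X. w y * (v x * wsum X (ws @ ws') (\<lambda>xs. T (y # x # xs))))"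
    by (intro sum.cong refl arg_cong2[where f=times] wsum_cong Cons.prems) (auto simp: add_mset_commute)
  finally show ?case by (simp add: sum_distrib_left)
qed simp

lemma wsum_integral:
  assumes "\<And>xs. xs \<in> lists X \<Longrightarrow> length xs = length ws \<Longrightarrow> integrable M (\<phi> xs)"
  shows "integrable M (\<lambda>z. wsum X ws (\<lambda>xs. \<phi> xs z))"
    and "(\<integral>z. wsum X ws (\<lambda>xs. \<phi> xs z) \<partial>M) = wsum X ws (\<lambda>xs. \<integral>z. \<phi> xs z \<partial>M)"
proof -
  have "integrable M (\<lambda>z. wsum X ws (\<lambda>xs. \<phi> xs z)) \<and>
     (\<integral>z. wsum X ws (\<lambda>xs. \<phi> xs z) \<partial>M) = wsum X ws (\<lambda>xs. \<integral>z. \<phi> xs z \<partial>M)"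
    using assms
  proof (induction ws arbitrary: \<phi>)
    case (Cons w ws)
    have "integrable M (\<lambda>z. wsum X ws (\<lambda>xs. \<phi> (x # xs) z)) \<and>
      (\<integral>z. wsum X ws (\<lambda>xs. \<phi> (x # xs) z) \<partial>M) = wsum X ws (\<lambda>xs. \<integral>z. \<phi> (x # xs) z \<partial>M)" if "x \<in> X" for x
      using that Cons.prems by (intro Cons.IH) auto
    then show ?case
      by (auto intro!: Bochner_Integration.integrable_sum sum.cong simp: Bochner_Integration.integral_sum)
  qed simp
  then show "integrable M (\<lambda>z. wsum X ws (\<lambda>xs. \<phi> xs z))"
    and "(\<integral>z. wsum X ws (\<lambda>xs. \<phi> xs z) \<partial>M) = wsum X ws (\<lambda>xs. \<integral>z. \<phi> xs z \<partial>M)" by auto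
qed

lemma borel_measurable_wsum:
  assumes "\<And>xs. xs \<in> lists X \<Longrightarrow> length xs = length ws \<Longrightarrow> \<phi> xs \<in> borel_measurable M"
  shows "(\<lambda>z. wsum X ws (\<lambda>xs. \<phi> xs z)) \<in> borel_measurable M"
  using assms
proof (induction ws arbitrary: \<phi>)
  case (Cons w ws)
  have "(\<lambda>z. wsum X ws (\<lambda>xs. \<phi> (x # xs) z)) \<in> borel_measurable M" if "x \<in> X" for x
    by (rule Cons.IH) (use that Cons.prems in simp)
  then show ?case by simp
qed simp

section \<open>The abstract hybrid setting and the effect of one user\<close>

text \<open>Collects what the argument needs from a protocol. \<open>T l xs\<close> will be the
  probability that the value released at \<open>l\<close> is positive on rows \<open>xs\<close>,
  \<open>V us\<close> the shuffled view of a group of users, \<open>post\<close> the simulation of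
  the other users from that view, and \<open>a\<close> the factor e^eps. In \<open>dp\<close> the
  changed row counts as a participant, hence the successor of \<open>length us\<close>.\<close>

locale tilted_hybrid =
  fixes X :: "'x set" and L :: "'l set" and \<psi> :: "'l \<Rightarrow> 'x \<Rightarrow> real" and T :: "'l \<Rightarrow> 'x list \<Rightarrow> real"
    and V :: "'x list \<Rightarrow> 'z measure" and Z :: "'z measure" and n :: nat and a \<delta> \<beta> :: real
  assumes X: "finite X" "X \<noteq> {}" and L: "finite L"
    and orth: "\<And>l l'. l \<in> L \<Longrightarrow> l' \<in> L \<Longrightarrow> (\<Sum>x\<in>X. \<psi> l x * \<psi> l' x) = (if l = l' then real (card X) else 0)"
    and mean0: "\<And>l. l \<in> L \<Longrightarrow> (\<Sum>x\<in>X. \<psi> l x) = 0"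
    and \<psi>1: "\<And>l x. l \<in> L \<Longrightarrow> x \<in> X \<Longrightarrow> \<bar>\<psi> l x\<bar> \<le> 1"
    and symm: "\<And>l xs ys. l \<in> L \<Longrightarrow> xs \<in> lists X \<Longrightarrow> mset xs = mset ys \<Longrightarrow> T l xs = T l ys"
    and T01: "\<And>l xs. l \<in> L \<Longrightarrow> xs \<in> lists X \<Longrightarrow> 0 \<le> T l xs \<and> T l xs \<le> 1"
    and V: "\<And>us. us \<in> lists X \<Longrightarrow> V us \<in> space (prob_algebra Z)"
    and post: "\<And>l ys. l \<in> L \<Longrightarrow> ys \<in> lists X \<Longrightarrow> \<exists>\<phi>\<in>borel_measurable Z.
      (\<forall>z. 0 \<le> \<phi> z \<and> \<phi> z \<le> 1) \<and> (\<forall>us\<in>lists X. T l (us @ ys) = (\<integral>z. \<phi> z \<partial>V us))"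
    and dp: "\<And>us x y E. us \<in> lists X \<Longrightarrow> n \<le> 3 * Suc (length us) \<Longrightarrow> Suc (length us) \<le> n \<Longrightarrow> x \<in> X \<Longrightarrow> y \<in> X \<Longrightarrow> E \<in> sets Z \<Longrightarrow>
      measure (V (us @ [x])) E \<le> a * measure (V (us @ [y])) E + \<delta>"
    and a: "1 \<le> a" and \<delta>: "0 \<le> \<delta>" and \<beta>: "0 \<le> \<beta>" "\<beta> \<le> 1"
begin

definition u :: "'x \<Rightarrow> real" where "u x = 1 / card X"

definition tilt :: "real \<Rightarrow> 'l \<Rightarrow> 'x \<Rightarrow> real" where "tilt t l x = (1 + t * \<psi> l x) / card X"

lemma cardX: "0 < card X" using X by (simp add: card_gt_0_iff)

lemma tilt_nonneg: "l \<in> L \<Longrightarrow> x \<in> X \<Longrightarrow> \<bar>t\<bar> \<le> 1 \<Longrightarrow> 0 \<le> tilt t l x"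
proof -
  assume "l \<in> L" "x \<in> X" "\<bar>t\<bar> \<le> 1"
  then have "\<bar>t * \<psi> l x\<bar> \<le> 1 * 1" unfolding abs_mult using \<psi>1 by (intro mult_mono) auto
  then show ?thesis by (auto simp: tilt_def abs_le_iff intro!: divide_nonneg_nonneg)
qed

lemma sum_tilt: "l \<in> L \<Longrightarrow> (\<Sum>x\<in>X. tilt t l x) = 1"
  using cardX mean0 by (simp add: tilt_def sum.distrib flip: sum_divide_distrib sum_distrib_left)

lemma u_eq_tilt: "u = tilt 0 l"
  by (auto simp: u_def tilt_def)

lemma tilt_half: "tilt (t / 2) l = (\<lambda>x. 1 / 2 * u x + 1 / 2 * tilt t l x)"
  by (simp add: fun_eq_iff u_def tilt_def add_divide_distrib)

lemma tilt_minus_u: "tilt t l = (\<lambda>x. 1 * u x + t * (u x * \<psi> l x))"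
  by (simp add: fun_eq_iff u_def tilt_def add_divide_distrib)

text \<open>The correlation bound after division by \<open>card X\<close>, that is, with the changed
  row averaged uniformly.\<close>

definition step_bound :: real where
  "step_bound = sqrt (real (card L)) * (a - 1) + 2 * \<delta> * real (card L)"

lemma step_bound_nonneg: "0 \<le> step_bound"
  using a \<delta> by (simp add: step_bound_def)

text \<open>The perturbed user comes last among those whose rows do not depend on \<open>l\<close>; the tilted users
  after it are a post-processing of the view of the first users.\<close>

lemma one_step:
  assumes i: "n \<le> 3 * Suc i" "Suc i \<le> n" and t: "\<bar>t\<bar> \<le> 1" and s: "\<bar>s\<bar> = 1"
  shows "s * (\<Sum>l\<in>L. wsum X (replicate i u @ (\<lambda>x. u x * \<psi> l x) # replicate j (tilt t l)) (T l)) \<le> step_bound"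
proof -
  have "\<forall>l ys. \<exists>\<phi>. l \<in> L \<longrightarrow> ys \<in> lists X \<longrightarrow> \<phi> \<in> borel_measurable Z \<and> (\<forall>z. 0 \<le> \<phi> z \<and> \<phi> z \<le> (1::real)) \<and>
    (\<forall>us\<in>lists X. T l (us @ ys) = (\<integral>z. \<phi> z \<partial>V us))"
    using post by blast
  then obtain \<phi> :: "'l \<Rightarrow> 'x list \<Rightarrow> 'z \<Rightarrow> real" where
    \<phi>m: "\<And>l ys. l \<in> L \<Longrightarrow> ys \<in> lists X \<Longrightarrow> \<phi> l ys \<in> borel_measurable Z"
    and \<phi>01: "\<And>l ys z. l \<in> L \<Longrightarrow> ys \<in> lists X \<Longrightarrow> 0 \<le> \<phi> l ys z \<and> \<phi> l ys z \<le> 1"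
    and T\<phi>: "\<And>l ys us. l \<in> L \<Longrightarrow> ys \<in> lists X \<Longrightarrow> us \<in> lists X \<Longrightarrow> T l (us @ ys) = (\<integral>z. \<phi> l ys z \<partial>V us)"
    by metis
  \<comment> \<open>The simulation is averaged over the tilted rows of the later users. All
    dependence on \<open>l\<close> moves into this test function, so the view itself remains free of
    \<open>l\<close>.\<close>
  define \<Phi> where "\<Phi> l z = wsum X (replicate j (tilt t l)) (\<lambda>ys. \<phi> l ys z)" for l z
  have \<Phi>01: "0 \<le> \<Phi> l z \<and> \<Phi> l z \<le> 1" if l: "l \<in> L" for l z
  proof
    have "wsum X (replicate j (tilt t l)) (\<lambda>_. 0) \<le> \<Phi> l z"
      unfolding \<Phi>_def using l t \<phi>01 by (intro wsum_mono) (auto intro: tilt_nonneg)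
    then show "0 \<le> \<Phi> l z" using l by (subst (asm) wsum_const) (auto simp: sum_tilt)
    have "\<Phi> l z \<le> wsum X (replicate j (tilt t l)) (\<lambda>_. 1)"
      unfolding \<Phi>_def using l t \<phi>01 by (intro wsum_mono) (auto intro: tilt_nonneg)
    then show "\<Phi> l z \<le> 1" using l by (subst (asm) wsum_const) (auto simp: sum_tilt)
  qed
  have \<Phi>m: "\<Phi> l \<in> borel_measurable Z" if "l \<in> L" for l
    unfolding \<Phi>_def using \<phi>m that by (intro borel_measurable_wsum) auto
  have T\<Phi>: "wsum X (replicate j (tilt t l)) (\<lambda>ys. T l (us @ ys)) = (\<integral>z. \<Phi> l z \<partial>V us)"
    if l: "l \<in> L" and us: "us \<in> lists X" for l us
  proof -
    interpret V: prob_space "V us" using V[OF us] by (simp add: space_prob_algebra)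
    have s: "sets (V us) = sets Z" using V[OF us] by (simp add: space_prob_algebra)
    have "integrable (V us) (\<phi> l ys)" if "ys \<in> lists X" for ys
      using \<phi>m[OF l that] \<phi>01[OF l that] measurable_cong_sets[OF s refl]
      by (intro V.integrable_const_bound[of _ 1]) auto
    then have "(\<integral>z. \<Phi> l z \<partial>V us) = wsum X (replicate j (tilt t l)) (\<lambda>ys. \<integral>z. \<phi> l ys z \<partial>V us)"
      unfolding \<Phi>_def by (intro wsum_integral(2)) auto
    also have "\<dots> = wsum X (replicate j (tilt t l)) (\<lambda>ys. T l (us @ ys))"
      using T\<phi> l us by (intro wsum_cong) auto
    finally show ?thesis ..
  qed
  have "s * (\<Sum>l\<in>L. wsum X (replicate i u @ (\<lambda>x. u x * \<psi> l x) # replicate j (tilt t l)) (T l)) =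
    wsum X (replicate i u) (\<lambda>us. s * (\<Sum>l\<in>L. \<Sum>x\<in>X. u x * \<psi> l x *
       wsum X (replicate j (tilt t l)) (\<lambda>ys. T l (us @ [x] @ ys))))"
    by (subst wsum_cmult, subst wsum_sum) (simp add: wsum_append)
  \<comment> \<open>It suffices to fix the rows \<open>us\<close> of the prefix: then
    \<open>V (us @ [x])\<close> is a kernel in the single row x, and the uniform average over
    \<open>us\<close> preserves the bound.\<close>
  also have "\<dots> \<le> wsum X (replicate i u) (\<lambda>_. step_bound)"
  proof (rule wsum_mono)
    fix us assume us: "us \<in> lists X" "length us = length (replicate i u)"
    have "s * (\<Sum>l\<in>L. \<Sum>x\<in>X. u x * \<psi> l x * wsum X (replicate j (tilt t l)) (\<lambda>ys. T l (us @ [x] @ ys))) =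
      (\<Sum>l\<in>L. \<Sum>x\<in>X. \<psi> l x * (\<integral>z. s * \<Phi> l z \<partial>V (us @ [x]))) / card X"
      using us T\<Phi>[where us="us @ [x]" for x]
      by (simp add: u_def sum_distrib_left sum_divide_distrib mult_ac)
    also have "\<dots> \<le> (real (card X) * step_bound) / card X"
      unfolding step_bound_def
    proof (intro divide_right_mono dp_correlation_bound[where Z=Z])
      show "(\<lambda>z. s * \<Phi> l z) \<in> borel_measurable Z" if "l \<in> L" for l
        using \<Phi>m[OF that] by simp
      show "\<bar>s * \<Phi> l z\<bar> \<le> 1" if "l \<in> L" for l z using \<Phi>01[OF that, of z] s by (simp add: abs_mult)
      show "V (us @ [x]) \<in> space (prob_algebra Z)" if "x \<in> X" for x
        using us that by (intro V) auto
      show "measure (V (us @ [x])) E \<le> a * measure (V (us @ [y])) E + \<delta>"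
        if "x \<in> X" "y \<in> X" "E \<in> sets Z" for x y E
        using us i that by (intro dp) auto
    qed (simp_all add: X L a orth mean0 \<psi>1)
    finally show "s * (\<Sum>l\<in>L. \<Sum>x\<in>X. u x * \<psi> l x * wsum X (replicate j (tilt t l)) (\<lambda>ys. T l (us @ [x] @ ys)))
       \<le> step_bound" using cardX by simp
  qed (auto simp: u_def)
  also have "\<dots> = step_bound"
    using cardX by (intro wsum_const) (auto simp: u_def)
  finally show ?thesis .
qed

section \<open>Resolving the mixed users and telescoping the tilted ones\<close>

text \<open>The r users with tilt t/2 are those whose coin, uniform or tilted by t, has not been
  tossed yet.\<close>

definition hyb :: "real \<Rightarrow> nat \<Rightarrow> nat \<Rightarrow> nat \<Rightarrow> 'l \<Rightarrow> real" where
  "hyb t i r j l = wsum X (replicate i u @ replicate r (tilt (t / 2) l) @ replicate j (tilt t l)) (T l)"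

text \<open>Every weight is \<open>tilt t' l\<close> for some t' of modulus at most 1, hence a
  probability vector.\<close>

lemma hyb_01:
  assumes "l \<in> L" "\<bar>t\<bar> \<le> 1"
  shows "0 \<le> hyb t i r j l \<and> hyb t i r j l \<le> 1"
proof -
  let ?ws = "replicate i u @ replicate r (tilt (t / 2) l) @ replicate j (tilt t l)"
  have ws: "\<exists>t'. w = tilt t' l \<and> \<bar>t'\<bar> \<le> 1" if w: "w \<in> set ?ws" for w
  proof -
    consider "w = tilt 0 l" | "w = tilt (t / 2) l" | "w = tilt t l"
      using w u_eq_tilt[of l] by (auto split: if_splits)
    then show ?thesis using assms(2) by cases (rule exI, rule conjI, assumption, simp)+
  qed
  have c: "wsum X ?ws (\<lambda>_. c) = c" for c
  proof (rule wsum_const)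
    fix w assume "w \<in> set ?ws"
    from ws[OF this] show "(\<Sum>x\<in>X. w x) = 1" using sum_tilt[OF assms(1)] by blast
  qed
  have nn: "0 \<le> w x" if "w \<in> set ?ws" "x \<in> X" for w x
    using ws[OF that(1)] tilt_nonneg[OF assms(1) that(2)] by blast
  have "wsum X ?ws (\<lambda>_. 0) \<le> wsum X ?ws (T l)" "wsum X ?ws (T l) \<le> wsum X ?ws (\<lambda>_. 1)"
    using T01[OF assms(1)] nn by (auto intro!: wsum_mono)
  then show ?thesis unfolding c hyb_def by simp
qed

text \<open>Tosses the coin of one mixed user; the symmetry of \<open>T\<close> then sorts this user
  into the uniform or the tilted block.\<close>

lemma hyb_split:
  assumes l: "l \<in> L"
  shows "hyb t i (Suc r) j l = (hyb t (Suc i) r j l + hyb t i r (Suc j) l) / 2"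
proof -
  let ?Q = "replicate r (tilt (t / 2) l)" and ?P = "replicate j (tilt t l)"
  have "hyb t i (Suc r) j l = wsum X (replicate i u @ tilt (t / 2) l # ?Q @ ?P) (T l)"
    by (simp add: hyb_def)
  also have "\<dots> = 1 / 2 * wsum X (replicate i u @ u # ?Q @ ?P) (T l) +
      1 / 2 * wsum X (replicate i u @ tilt t l # ?Q @ ?P) (T l)"
    by (subst tilt_half) (rule wsum_linear)
  also have "wsum X (replicate i u @ tilt t l # ?Q @ ?P) (T l) =
    wsum X ((replicate i u @ ?Q) @ tilt t l # ?P) (T l)"
    using symm[OF l] by (subst (1 2) wsum_move) auto
  also have "wsum X (replicate i u @ u # ?Q @ ?P) (T l) = hyb t (Suc i) r j l"
    by (simp add: hyb_def replicate_app_Cons_same)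
  also have "wsum X ((replicate i u @ ?Q) @ tilt t l # ?P) (T l) = hyb t i r (Suc j) l"
    by (simp add: hyb_def)
  finally show ?thesis by simp
qed

lemma hyb_step:
  assumes l: "l \<in> L"
  shows "hyb t i 0 (Suc j) l =
    hyb t (Suc i) 0 j l + t * wsum X (replicate i u @ (\<lambda>x. u x * \<psi> l x) # replicate j (tilt t l)) (T l)"
proof -
  have "hyb t i 0 (Suc j) l = wsum X (replicate i u @ tilt t l # replicate j (tilt t l)) (T l)"
    by (simp add: hyb_def)
  also have "\<dots> = 1 * wsum X (replicate i u @ u # replicate j (tilt t l)) (T l) +
     t * wsum X (replicate i u @ (\<lambda>x. u x * \<psi> l x) # replicate j (tilt t l)) (T l)"
    by (rule wsum_linear[where f=u and g="\<lambda>x. u x * \<psi> l x" and a=1 and b=t, folded tilt_minus_u])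
  finally show ?thesis by (simp add: hyb_def replicate_app_Cons_same)
qed

definition gap :: "nat \<Rightarrow> nat \<Rightarrow> nat \<Rightarrow> real" where
  "gap i r j = (\<Sum>l\<in>L. hyb \<beta> i r j l - hyb (- \<beta>) i r j l)"

text \<open>Tilted users turn uniform one at a time until both hypotheses coincide at j = 0. Each
  step costs \<beta> times \<open>step_bound\<close> for either sign of the tilt. The uniform prefix
  only grows, so the condition on its length is inherited.\<close>

lemma gap_no_half:
  assumes "i + j = n" "n \<le> 3 * Suc i"
  shows "gap i 0 j \<le> real j * (2 * \<beta> * step_bound)"
  using assms
proof (induction j arbitrary: i)
  case 0
  have "hyb \<beta> i 0 0 l = hyb (- \<beta>) i 0 0 l" for l by (simp add: hyb_def)
  then show ?case by (simp add: gap_def)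
next
  case (Suc j)
  define W where "W t = (\<Sum>l\<in>L. wsum X (replicate i u @ (\<lambda>x. u x * \<psi> l x) # replicate j (tilt t l)) (T l))" for t
  have "(\<Sum>l\<in>L. hyb t i 0 (Suc j) l) = (\<Sum>l\<in>L. hyb t (Suc i) 0 j l) + t * W t" for t
    by (simp add: W_def hyb_step sum.distrib sum_distrib_left)
  then have "gap i 0 (Suc j) = gap (Suc i) 0 j + \<beta> * (1 * W \<beta>) + \<beta> * (1 * W (- \<beta>))"
    by (simp add: gap_def sum_subtractf)
  also have "\<dots> \<le> real j * (2 * \<beta> * step_bound) + \<beta> * step_bound + \<beta> * step_bound"
    unfolding W_def using Suc.prems \<beta>
    by (intro add_mono Suc.IH mult_left_mono one_step) auto
  finally show ?case by (simp add: algebra_simps)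
qed

text \<open>If more than two thirds of the users are tilted, privacy of the first users gives nothing;
  that case is charged to the \<open>j\<close> tilted users, whose expected number is \<open>n / 2\<close> (Markov).\<close>

lemma gap_bound:
  assumes "i + r + j = n"
  shows "gap i r j \<le> (3 / (2 * real n) * card L + 2 * \<beta> * step_bound) * (real j + real r / 2)"
  using assms
proof (induction r arbitrary: i j)
  case 0
  show ?case
  proof (cases "n \<le> 3 * Suc i")
    case True
    then have "gap i 0 j \<le> real j * (2 * \<beta> * step_bound)" using 0 by (intro gap_no_half) auto
    also have "\<dots> \<le> real j * (3 / (2 * real n) * card L + 2 * \<beta> * step_bound)"
      by (intro mult_left_mono) auto
    finally show ?thesis by (simp add: mult.commute)
  next
    case False
    have "gap i 0 j \<le> (\<Sum>l\<in>L. 1)"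
      unfolding gap_def
    proof (rule sum_mono)
      fix l assume l: "l \<in> L"
      show "hyb \<beta> i 0 j l - hyb (- \<beta>) i 0 j l \<le> 1"
        using hyb_01[OF l, of \<beta> i 0 j] hyb_01[OF l, of "- \<beta>" i 0 j] \<beta> by simp
    qed
    also have "\<dots> = 1 * real (card L)" by simp
    \<comment> \<open>Here 3 (i + 1) < n, so j = n - i exceeds 2n/3 and the Markov factor 3j/(2n) is
      at least 1.\<close>
    also have "\<dots> \<le> (3 / (2 * real n) * real j) * card L"
      using False 0 by (intro mult_right_mono) (auto simp: field_simps)
    also have "\<dots> \<le> (3 / (2 * real n) * real j) * card L + 2 * \<beta> * step_bound * real j"
      using \<beta> step_bound_nonneg by simp
    finally show ?thesis by (simp add: algebra_simps)
  qed
next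
  case (Suc r)
  define \<kappa> where "\<kappa> = 3 / (2 * real n) * card L + 2 * \<beta> * step_bound"
  have "gap i (Suc r) j = (gap (Suc i) r j + gap i r (Suc j)) / 2"
    by (simp add: gap_def hyb_split sum_subtractf sum.distrib flip: sum_divide_distrib) (simp add: field_simps)
  \<comment> \<open>The quantity j + r/2 is the expected final number of tilted users. Tossing one
    coin preserves its mean, so a bound linear in it passes through the induction.\<close>
  also have "\<dots> \<le> (\<kappa> * (real j + real r / 2) + \<kappa> * (real (Suc j) + real r / 2)) / 2"
    unfolding \<kappa>_def using Suc.prems by (intro divide_right_mono add_mono Suc.IH) auto
  also have "\<dots> = \<kappa> * (real j + real (Suc r) / 2)" by (simp add: field_simps)
  finally show ?case unfolding \<kappa>_def .
qed

text \<open>At the start no coin has been tossed and the expected number of tilted users is n/2,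
  which turns 3/(2n) into 3/4 and 2\<beta> into n\<beta>.\<close>

lemma distinguishing_bound:
  "(\<Sum>l\<in>L. wsum X (replicate n (tilt (\<beta> / 2) l)) (T l) - wsum X (replicate n (tilt (- \<beta> / 2) l)) (T l))
    \<le> 3 / 4 * card L + real n * \<beta> * step_bound"
proof -
  have "gap 0 n 0 \<le> (3 / (2 * real n) * card L + 2 * \<beta> * step_bound) * (real n / 2)"
    using gap_bound[of 0 n 0] by simp
  also have "\<dots> \<le> 3 / 4 * card L + real n * \<beta> * step_bound"
    \<comment> \<open>For n = 0 the left-hand side vanishes because of its factor n/2, whatever
      3/(2n) stands for.\<close>
    by (cases "n = 0") (auto simp: field_simps)
  finally show ?thesis by (simp add: gap_def hyb_def)
qed

end

subsection \<open>Parities\<close>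

lemma expectation_replicate_pmf:
  assumes X: "finite X" and P: "set_pmf P \<subseteq> X"
  shows "measure_pmf.expectation (replicate_pmf n P) f = wsum X (replicate n (pmf P)) f"
proof (induction n arbitrary: f)
  case (Suc n)
  have fin: "finite (set_pmf (replicate_pmf n P))"
    using finite_lists_length_eq[OF finite_subset[OF P X], of n]
    by (simp add: set_replicate_pmf lists_eq_set)
  have "measure_pmf.expectation (replicate_pmf (Suc n) P) f =
    measure_pmf.expectation (P \<bind> (\<lambda>x. map_pmf ((#) x) (replicate_pmf n P))) f"
    by (simp add: map_pmf_def)
  also have "\<dots> = (\<Sum>x\<in>X. pmf P x * measure_pmf.expectation (map_pmf ((#) x) (replicate_pmf n P)) f)"
    using X P fin by (subst pmf_expectation_bind[of X]) auto
  also have "\<dots> = wsum X (replicate (Suc n) (pmf P)) f" by (simp add: Suc.IH)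
  finally show ?case .
qed simp

definition parity :: "nat set \<Rightarrow> (nat \<Rightarrow> real) \<Rightarrow> real" where
  "parity l x = (\<Prod>j\<in>l. x j)"

text \<open>The empty set is left out: its parity is constantly 1, so it neither has mean zero nor
  can be tilted. Likewise \<open>binom_le\<close> starts its sum at j = 1.\<close>

definition parities :: "nat \<Rightarrow> nat \<Rightarrow> nat set set" where
  "parities d k = {l. l \<subseteq> {1..d} \<and> l \<noteq> {} \<and> card l \<le> k}"

lemma finite_parities: "finite (parities d k)"
  by (rule finite_subset[of _ "Pow {1..d}"]) (auto simp: parities_def)

lemma card_parities: "card (parities d k) = binom_le d k"
proof -
  have "parities d k = (\<Union>j\<in>{1..k}. {l. l \<subseteq> {1..d} \<and> card l = j})"
  proof (intro equalityI subsetI)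
    fix l assume l: "l \<in> parities d k"
    then have "finite l" by (auto simp: parities_def intro: finite_subset)
    then have "card l \<in> {1..k}" using l by (auto simp: parities_def Suc_le_eq card_gt_0_iff)
    then show "l \<in> (\<Union>j\<in>{1..k}. {l. l \<subseteq> {1..d} \<and> card l = j})" using l by (auto simp: parities_def)
  qed (auto simp: parities_def)
  also have "card \<dots> = (\<Sum>j\<in>{1..k}. card {l. l \<subseteq> {1..d} \<and> card l = j})"
    by (rule card_UN_disjoint) auto
  also have "\<dots> = binom_le d k"
    unfolding binom_le_def by (intro sum.cong refl) (simp add: n_subsets)
  finally show ?thesis .
qed

lemma finite_sign_cube: "finite (sign_cube d)" and sign_cube_nonempty: "sign_cube d \<noteq> {}"
  and card_sign_cube: "card (sign_cube d) = 2 ^ d"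
proof -
  show "finite (sign_cube d)" by (auto simp: sign_cube_def intro: finite_PiE)
  show c: "card (sign_cube d) = 2 ^ d" by (simp add: sign_cube_def card_PiE card_insert_if numeral_2_eq_2)
  show "sign_cube d \<noteq> {}" using c by force
qed

lemma abs_parity:
  assumes "l \<subseteq> {1..d}" "x \<in> sign_cube d"
  shows "\<bar>parity l x\<bar> = 1"
proof -
  have "\<bar>x j\<bar> = 1" if "j \<in> l" for j
  proof -
    have "x j \<in> {-1, 1}" using assms that unfolding sign_cube_def by (blast intro: PiE_mem)
    then show ?thesis by auto
  qed
  then show ?thesis unfolding parity_def abs_prod by simp
qed

text \<open>The sum over the cube factorises into sums over single coordinates, and a coordinate
  lying in exactly one of the two sets contributes the factor -1 + 1 = 0.\<close>

lemma parity_orthogonal: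
  assumes "l \<subseteq> {1..d}" "l' \<subseteq> {1..d}"
  shows "(\<Sum>x\<in>sign_cube d. parity l x * parity l' x) = (if l = l' then real (card (sign_cube d)) else 0)"
proof -
  define f where "f j v = (if j \<in> l then v else 1) * (if j \<in> l' then v else (1::real))" for j v
  have p: "parity l x = (\<Prod>j\<in>{1..d}. if j \<in> l then x j else 1)" if "l \<subseteq> {1..d}" for l x
    unfolding parity_def using that by (simp add: prod.If_cases Int_absorb1)
  have "(\<Sum>x\<in>sign_cube d. parity l x * parity l' x) = (\<Sum>x\<in>sign_cube d. \<Prod>j\<in>{1..d}. f j (x j))"
    unfolding p[OF assms(1)] p[OF assms(2)] f_def by (simp add: prod.distrib)
  also have "\<dots> = (\<Prod>j\<in>{1..d}. \<Sum>v\<in>{-1, 1}. f j v)"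
    unfolding sign_cube_def by (rule prod_sum_PiE[symmetric]) auto
  also have "\<dots> = (\<Prod>j\<in>{1..d}. if j \<in> l \<longleftrightarrow> j \<in> l' then 2 else 0)"
    by (intro prod.cong refl) (auto simp: f_def)
  also have "\<dots> = (if l = l' then real (card (sign_cube d)) else 0)"
  proof (cases "l = l'")
    case False
    then obtain j where "j \<in> {1..d}" "\<not> (j \<in> l \<longleftrightarrow> j \<in> l')" using assms by blast
    then have "(\<Prod>j\<in>{1..d}. if j \<in> l \<longleftrightarrow> j \<in> l' then 2 else (0::real)) = 0"
      by (intro prod_zero) auto
    then show ?thesis using False by simp
  qed (simp add: card_sign_cube)
  finally show ?thesis .
qed

lemma sum_parity:
  assumes "l \<subseteq> {1..d}" "l \<noteq> {}"
  shows "(\<Sum>x\<in>sign_cube d. parity l x) = 0"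
  using parity_orthogonal[OF assms(1), of "{}"] assms(2) by (simp add: parity_def)

section \<open>Tilted laws on the cube\<close>

definition tilted_pmf :: "nat \<Rightarrow> real \<Rightarrow> nat set \<Rightarrow> (nat \<Rightarrow> real) pmf" where
  "tilted_pmf d t l =
     embed_pmf (\<lambda>x. if x \<in> sign_cube d then (1 + t * parity l x) / card (sign_cube d) else 0)"

text \<open>The perturbation has sum zero over the cube, which gives total mass 1; its inner product
  with \<open>parity l\<close> gives the mean t, by orthogonality with l = l'.\<close>

lemma
  assumes l: "l \<subseteq> {1..d}" "l \<noteq> {}" and t: "\<bar>t\<bar> \<le> 1"
  shows pmf_tilted: "pmf (tilted_pmf d t l) x =
      (if x \<in> sign_cube d then (1 + t * parity l x) / card (sign_cube d) else 0)"
    and set_tilted: "set_pmf (tilted_pmf d t l) \<subseteq> sign_cube d"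
    and parity_mean_tilted: "parity_mean (tilted_pmf d t l) l = t"
proof -
  let ?f = "\<lambda>x. if x \<in> sign_cube d then (1 + t * parity l x) / card (sign_cube d) else 0"
  have pos: "0 < real (card (sign_cube d))" by (simp add: card_sign_cube)
  have nn: "0 \<le> ?f x" for x
  proof (cases "x \<in> sign_cube d")
    case True
    have "\<bar>t * parity l x\<bar> \<le> 1" using t abs_parity[OF l(1) True] by (simp add: abs_mult)
    then show ?thesis using True by (auto simp: abs_le_iff intro!: divide_nonneg_nonneg)
  qed simp
  have "(\<Sum>x\<in>sign_cube d. ?f x) = 1"
    using pos sum_parity[OF l]
    by (simp add: sum.distrib flip: sum_divide_distrib sum_distrib_left)
  moreover have "(\<integral>\<^sup>+x. ennreal (?f x) \<partial>count_space UNIV) = (\<Sum>x\<in>sign_cube d. ennreal (?f x))"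
    by (rule nn_integral_count_space'[OF finite_sign_cube]) auto
  moreover have "(\<Sum>x\<in>sign_cube d. ennreal (?f x)) = ennreal (\<Sum>x\<in>sign_cube d. ?f x)"
    by (rule sum_ennreal) (rule nn)
  ultimately have "(\<integral>\<^sup>+x. ennreal (?f x) \<partial>count_space UNIV) = 1" by simp
  with nn have pmf: "pmf (tilted_pmf d t l) x = ?f x" for x
    unfolding tilted_pmf_def by (rule pmf_embed_pmf)
  show "pmf (tilted_pmf d t l) x = ?f x" by (rule pmf)
  show set: "set_pmf (tilted_pmf d t l) \<subseteq> sign_cube d"
    using pmf by (auto simp: set_pmf_iff split: if_splits)
  have "parity_mean (tilted_pmf d t l) l = (\<Sum>x\<in>sign_cube d. ?f x * parity l x)"
    unfolding parity_mean_def parity_def[symmetric]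
    using set by (subst integral_measure_pmf[OF finite_sign_cube[of d]]) (auto simp: pmf)
  also have "\<dots> = ((\<Sum>x\<in>sign_cube d. parity l x) + t * (\<Sum>x\<in>sign_cube d. parity l x * parity l x)) / card (sign_cube d)"
    unfolding sum_distrib_left sum.distrib[symmetric] sum_divide_distrib
    by (intro sum.cong refl) (simp add: algebra_simps)
  also have "\<dots> = t"
    using pos sum_parity[OF l] parity_orthogonal[OF l(1) l(1)] by simp
  finally show "parity_mean (tilted_pmf d t l) l = t" .
qed

section \<open>From protocols to the hybrid setting\<close>

text \<open>Lets the accuracy event be compared with a sign event without showing it measurable: a
  set outside \<open>sets M\<close> has measure 0 by convention.\<close>

lemma measure_le_superset:
  assumes "finite_measure M" "B \<in> sets M" "A \<subseteq> B"
  shows "measure M A \<le> measure M B"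
  using assms finite_measure.finite_measure_mono[of M A B]
  by (cases "A \<in> sets M") (auto simp: measure_notin_sets)

lemma robust_privacy_last_row:
  assumes rob: "robustly_shuffle_private X Y \<epsilon> \<delta> (1 / 3) \<P>"
    and us: "us \<in> lists X" and n: "n \<le> 3 * Suc (length us)" "Suc (length us) \<le> n"
    and xy: "x \<in> X" "y \<in> X" and E: "E \<in> sets (public \<P> n \<Otimes>\<^sub>M list_space Y)"
  shows "measure (shuffled_view Y \<P> n (us @ [x])) E \<le> exp \<epsilon> * measure (shuffled_view Y \<P> n (us @ [y])) E + \<delta>"
proof -
  let ?m = "Suc (length us)"
  \<comment> \<open>The participation rate is \<gamma>' = ?m / n; n is positive because at least one
    user takes part and ?m \<le> n.\<close>
  have "real ?m = (real ?m / real n) * real n" "1 / 3 \<le> real ?m / real n"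
    using n by (auto simp: field_simps)
  then have "differentially_private X ?m (public \<P> n \<Otimes>\<^sub>M list_space Y) \<epsilon> \<delta> (shuffled_view Y \<P> n)"
    using rob unfolding robustly_shuffle_private_def by blast
  moreover have "{i. i < ?m \<and> (us @ [x]) ! i \<noteq> (us @ [y]) ! i} \<subseteq> {length us}"
    by (auto simp: nth_append split: if_splits)
  then have "card {i. i < ?m \<and> (us @ [x]) ! i \<noteq> (us @ [y]) ! i} \<le> 1"
    using card_mono[of "{length us}"] by fastforce
  ultimately show ?thesis
    unfolding differentially_private_def using us xy E by simp
qed

text \<open>Multiply 1 - x \<le> e^(-x) by e^x.\<close>

lemma exp_minus_one_le: "exp x - 1 \<le> x * exp (x::real)"
proof -
  have "(1 - x) * exp x \<le> exp (- x) * exp x"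
    using exp_ge_add_one_self[of "- x"] by (intro mult_right_mono) auto
  then show ?thesis by (simp add: algebra_simps flip: exp_add)
qed

text \<open>The constant 23/100 is 98/100 - 3/4: the advantage of the sign test, 99/100 - 1/100,
  less the Markov loss. The factor 4\<alpha> bounds the tilt \<beta>.\<close>

lemma parities_sample_inequality:
  fixes Y :: "'y measure" and \<P> :: "('w, nat \<Rightarrow> real, 'y, nat set \<Rightarrow> real) protocol"
  assumes \<alpha>: "0 < \<alpha>" "\<alpha> < 1 / 2" and \<epsilon>: "0 < \<epsilon>" and \<delta>: "0 \<le> \<delta>"
    and \<P>: "shuffle_protocol (sign_cube d) Y (query_space d) \<P>"
    and rob: "robustly_shuffle_private (sign_cube d) Y \<epsilon> \<delta> (1 / 3) \<P>"
    and rel: "releases_parities d k \<alpha> n (run_protocol Y \<P> n)"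
  defines "N \<equiv> real (binom_le d k)"
  shows "23 / 100 * N \<le> real n * (4 * \<alpha>) * (sqrt N * (exp \<epsilon> - 1) + 2 * \<delta> * N)"
proof -
  define X where "X = sign_cube d"
  \<comment> \<open>The cap at 1 keeps the tilted weights nonnegative. The sign test needs \<beta>/2
    > \<alpha>: this is 2\<alpha> > \<alpha> without the cap and 1/2 > \<alpha> with it.\<close>
  define \<beta> where "\<beta> = min 1 (4 * \<alpha>)"
  have \<beta>_bounds: "0 \<le> \<beta>" "\<beta> \<le> 1" "\<beta> \<le> 4 * \<alpha>" "\<alpha> < \<beta> / 2" using \<alpha> by (auto simp: \<beta>_def min_def)
  define Pos where "Pos l = {F \<in> space (query_space d). 0 < F l}" for l
  have Pos: "Pos l \<in> sets (query_space d)" if "l \<in> parities d k" for l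
  proof -
    have [measurable]: "(\<lambda>F. F l) \<in> borel_measurable (query_space d)"
      using that unfolding query_space_def by (intro measurable_component_singleton) (auto simp: parities_def)
    show ?thesis unfolding Pos_def by measurable
  qed
  define T where "T l xs = measure (run_protocol Y \<P> n xs) (Pos l)" for l xs
  have run: "prob_space (run_protocol Y \<P> n xs)" "sets (run_protocol Y \<P> n xs) = sets (query_space d)"
    if "xs \<in> lists X" for xs
    using run_protocol_in_prob_algebra[OF \<P>] that by (auto simp: space_prob_algebra X_def)
  interpret tilted_hybrid X "parities d k" parity T "shuffled_view Y \<P> n" "public \<P> n \<Otimes>\<^sub>M list_space Y" n
    "exp \<epsilon>" \<delta> \<beta>
  proof
    show "(\<Sum>x\<in>X. parity l x * parity l' x) = (if l = l' then real (card X) else 0)"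
      if "l \<in> parities d k" "l' \<in> parities d k" for l l'
      using that parity_orthogonal unfolding X_def parities_def by blast
    show "(\<Sum>x\<in>X. parity l x) = 0" if "l \<in> parities d k" for l
      using that sum_parity unfolding X_def parities_def by blast
    show "\<bar>parity l x\<bar> \<le> 1" if "l \<in> parities d k" "x \<in> X" for l x
      using that abs_parity[of l d x] unfolding X_def parities_def by simp
    show "T l xs = T l ys" if "l \<in> parities d k" "xs \<in> lists X" "mset xs = mset ys" for l xs ys
      unfolding T_def using run_protocol_mset[OF \<P> Pos[OF that(1)] _ that(3)] that(2) by (simp add: X_def)
    show "0 \<le> T l xs \<and> T l xs \<le> 1" if "l \<in> parities d k" "xs \<in> lists X" for l xs
      using prob_space.prob_le_1[OF run(1)[OF that(2)]] by (simp add: T_def)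
    show "shuffled_view Y \<P> n us \<in> space (prob_algebra (public \<P> n \<Otimes>\<^sub>M list_space Y))" if "us \<in> lists X" for us
      by (rule shuffled_view_in_prob_algebra) (use \<P> that in \<open>auto simp: shuffle_protocol_def X_def\<close>)
    show "\<exists>\<phi>\<in>borel_measurable (public \<P> n \<Otimes>\<^sub>M list_space Y). (\<forall>z. 0 \<le> \<phi> z \<and> \<phi> z \<le> 1) \<and>
      (\<forall>us\<in>lists X. T l (us @ ys) = (\<integral>z. \<phi> z \<partial>shuffled_view Y \<P> n us))"
      if l: "l \<in> parities d k" and "ys \<in> lists X" for l ys
    proof -
      have ys: "ys \<in> lists (sign_cube d)" using that(2) by (simp only: X_def)
      obtain \<phi> :: "'w \<times> 'y list \<Rightarrow> real" where \<phi>: "\<phi> \<in> borel_measurable (public \<P> n \<Otimes>\<^sub>M list_space Y)"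
        "\<And>z. 0 \<le> \<phi> z" "\<And>z. \<phi> z \<le> 1"
        "\<And>us. us \<in> lists (sign_cube d) \<Longrightarrow>
          measure (run_protocol Y \<P> n (us @ ys)) (Pos l) = (\<integral>z. \<phi> z \<partial>shuffled_view Y \<P> n us)"
        by (rule run_protocol_append[OF \<P> Pos[OF l] ys, where n=n]) (rule that)
      then show ?thesis unfolding T_def X_def by blast
    qed
    show "measure (shuffled_view Y \<P> n (us @ [x])) E \<le> exp \<epsilon> * measure (shuffled_view Y \<P> n (us @ [y])) E + \<delta>"
      if "us \<in> lists X" "n \<le> 3 * Suc (length us)" "Suc (length us) \<le> n" "x \<in> X" "y \<in> X"
        "E \<in> sets (public \<P> n \<Otimes>\<^sub>M list_space Y)" for us x y E
      using robust_privacy_last_row[OF rob] that unfolding X_def by blast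
  qed (use \<beta>_bounds \<delta> \<epsilon> in \<open>simp_all add: X_def finite_sign_cube sign_cube_nonempty finite_parities\<close>)
  define Acc where "Acc t l = {F \<in> space (query_space d). accurate d k \<alpha> (tilted_pmf d t l) F}" for t l
  have accurate_run: "99 / 100 \<le> wsum X (replicate n (tilt t l)) (\<lambda>xs. measure (run_protocol Y \<P> n xs) (Acc t l))"
    if "l \<in> parities d k" "\<bar>t\<bar> \<le> 1" for l t
  proof -
    have l: "l \<subseteq> {1..d}" "l \<noteq> {}" using that(1) by (auto simp: parities_def)
    let ?p = "tilted_pmf d t l" and ?f = "\<lambda>xs. measure (run_protocol Y \<P> n xs) (Acc t l)"
    have "99 / 100 \<le> measure_pmf.expectation (replicate_pmf n ?p) ?f"
      using rel set_tilted[OF l that(2)] unfolding releases_parities_def Acc_def by blast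
    also have "\<dots> = wsum X (replicate n (pmf ?p)) ?f"
      unfolding X_def by (rule expectation_replicate_pmf[OF finite_sign_cube set_tilted[OF l that(2)]])
    also have "\<dots> = wsum X (replicate n (tilt t l)) ?f"
    proof -
      have "pmf ?p x = tilt t l x" if "x \<in> X" for x
        using that unfolding tilt_def pmf_tilted[OF l \<open>\<bar>t\<bar> \<le> 1\<close>] by (simp add: X_def)
      then have "wsum X (replicate m (pmf ?p)) f = wsum X (replicate m (tilt t l)) f" for m f
        by (induction m arbitrary: f) simp_all
      then show ?thesis .
    qed
    finally show ?thesis .
  qed
  have gap: "98 / 100 \<le> wsum X (replicate n (tilt (\<beta> / 2) l)) (T l) - wsum X (replicate n (tilt (- \<beta> / 2) l)) (T l)"
    if l: "l \<in> parities d k" for l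
  proof -
    have l': "l \<subseteq> {1..d}" "l \<noteq> {}" "card l \<le> k" using l by (auto simp: parities_def)
    have mean: "parity_mean (tilted_pmf d t l) l = t" if "\<bar>t\<bar> \<le> 1" for t
      using parity_mean_tilted[OF l'(1,2) that] .
    have b: "\<bar>\<beta> / 2\<bar> \<le> 1" "\<bar>- \<beta> / 2\<bar> \<le> 1" using \<beta>_bounds by auto
    have ws: "0 \<le> w x" if "w \<in> set (replicate n (tilt t l))" "x \<in> X" "\<bar>t\<bar> \<le> 1" for w x t
      using that tilt_nonneg[OF l] by (auto split: if_splits)
    have acc: "F \<in> space (query_space d)" "\<bar>F l - t\<bar> \<le> \<alpha>" if "F \<in> Acc t l" "\<bar>t\<bar> \<le> 1" for F t
    proof -
      show "F \<in> space (query_space d)" using that(1) by (simp add: Acc_def)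
      have "\<bar>F l - parity_mean (tilted_pmf d t l) l\<bar> \<le> \<alpha>"
        using that(1) l'(1,3) unfolding Acc_def accurate_def by blast
      then show "\<bar>F l - t\<bar> \<le> \<alpha>" unfolding mean[OF that(2)] .
    qed
    have "Acc (\<beta> / 2) l \<subseteq> Pos l"
    proof
      fix F assume "F \<in> Acc (\<beta> / 2) l"
      from acc[OF this b(1)] show "F \<in> Pos l" using \<beta>_bounds(4) by (simp add: Pos_def abs_le_iff)
    qed
    then have "wsum X (replicate n (tilt (\<beta> / 2) l)) (\<lambda>xs. measure (run_protocol Y \<P> n xs) (Acc (\<beta> / 2) l))
      \<le> wsum X (replicate n (tilt (\<beta> / 2) l)) (T l)"
      unfolding T_def using ws[OF _ _ b(1)] run Pos[OF l]
      by (intro wsum_mono measure_le_superset) (auto simp: prob_space.finite_measure)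
    then have 1: "99 / 100 \<le> wsum X (replicate n (tilt (\<beta> / 2) l)) (T l)"
      using accurate_run[OF l b(1)] by simp
    have "Acc (- \<beta> / 2) l \<subseteq> space (query_space d) - Pos l"
    proof
      fix F assume "F \<in> Acc (- \<beta> / 2) l"
      from acc[OF this b(2)] show "F \<in> space (query_space d) - Pos l"
        using \<beta>_bounds(4) by (simp add: Pos_def abs_le_iff)
    qed
    then have sub: "measure (run_protocol Y \<P> n xs) (Acc (- \<beta> / 2) l) \<le> 1 - T l xs" if xs: "xs \<in> lists X" for xs
    proof -
      interpret R: prob_space "run_protocol Y \<P> n xs" by (rule run(1)[OF xs])
      have s: "space (run_protocol Y \<P> n xs) = space (query_space d)"
        by (rule sets_eq_imp_space_eq[OF run(2)[OF xs]])
      have P: "Pos l \<in> R.events" using Pos[OF l] run(2)[OF xs] by simp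
      have "measure (run_protocol Y \<P> n xs) (Acc (- \<beta> / 2) l) \<le>
        measure (run_protocol Y \<P> n xs) (space (run_protocol Y \<P> n xs) - Pos l)"
        by (rule measure_le_superset[OF R.finite_measure_axioms sets.compl_sets[OF P]])
           (use \<open>Acc (- \<beta> / 2) l \<subseteq> _\<close> in \<open>simp add: s\<close>)
      also have "\<dots> = 1 - T l xs" unfolding T_def by (rule R.prob_compl[OF P])
      finally show ?thesis .
    qed
    have "wsum X (replicate n (tilt (- \<beta> / 2) l)) (\<lambda>xs. measure (run_protocol Y \<P> n xs) (Acc (- \<beta> / 2) l))
      \<le> wsum X (replicate n (tilt (- \<beta> / 2) l)) (\<lambda>xs. 1 - T l xs)"
      using ws[OF _ _ b(2)] sub by (intro wsum_mono) auto
    also have "\<dots> = 1 - wsum X (replicate n (tilt (- \<beta> / 2) l)) (T l)"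
      unfolding wsum_diff using sum_tilt[OF l] by (subst wsum_const) auto
    finally have "wsum X (replicate n (tilt (- \<beta> / 2) l)) (T l) \<le> 1 / 100"
      using accurate_run[OF l b(2)] by simp
    with 1 show ?thesis by simp
  qed
  have N: "real (card (parities d k)) = N" by (simp add: N_def card_parities)
  have "98 / 100 * N = (\<Sum>l\<in>parities d k. 98 / 100)" by (simp add: N)
  also have "\<dots> \<le> 3 / 4 * N + real n * \<beta> * step_bound"
    using sum_mono[OF gap] distinguishing_bound unfolding N by (rule order_trans)
  also have "\<dots> \<le> 3 / 4 * N + real n * (4 * \<alpha>) * step_bound"
    using \<beta>_bounds step_bound_nonneg by (intro add_left_mono mult_right_mono mult_left_mono) auto
  finally show ?thesis by (simp add: step_bound_def N)
qed

section \<open>Choice of constants and conclusion\<close>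

text \<open>The terms j = 1, 2 already give at least 2 + 1. The value 3 matters because it exceeds
  e, which makes the logarithm in the smallness condition on \<delta> at least 1.\<close>

lemma binom_le_ge_3:
  assumes "1 < k" "k \<le> d"
  shows "3 \<le> binom_le d k"
proof -
  have "(d choose 1) + (d choose 2) = (\<Sum>j\<in>{1, 2}. d choose j)" by simp
  also have "\<dots> \<le> binom_le d k" unfolding binom_le_def using assms by (intro sum_mono2) auto
  finally have "d + (d choose 2) \<le> binom_le d k" by simp
  moreover have "1 \<le> d choose 2" using assms by (simp add: Suc_le_eq zero_less_binomial_iff)
  ultimately show ?thesis using assms by linarith
qed

theorem theorem6p3:
  fixes \<epsilon>max :: real
  assumes "\<epsilon>max > 0"
  shows "\<exists>c > 0. \<exists>C > 0.
    \<forall>(d :: nat) (k :: nat) (n :: nat) (\<alpha> :: real) (\<epsilon> :: real) (\<delta> :: real)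
      (Y :: real measure) (\<P> :: (real, nat \<Rightarrow> real, real, nat set \<Rightarrow> real) protocol).
      1 < k \<and> k \<le> d \<and> 0 < \<alpha> \<and> \<alpha> < 1 / 2 \<and> 0 < \<epsilon> \<and> \<epsilon> \<le> \<epsilon>max \<and> 0 \<le> \<delta> \<and> \<delta> \<le> 1 \<and>
      shuffle_protocol (sign_cube d) Y (query_space d) \<P> \<and>
      robustly_shuffle_private (sign_cube d) Y \<epsilon> \<delta> (1 / 3) \<P> \<and>
      releases_parities d k \<alpha> n (run_protocol Y \<P> n) \<and>
      \<delta> * ln (real (binom_le d k) / \<delta>) \<le> c * \<alpha>\<^sup>2 * \<epsilon>\<^sup>2 / real (binom_le d k)
      \<longrightarrow> real n \<ge> C * sqrt (real (binom_le d k)) / (\<alpha> * \<epsilon>)"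
proof -
  \<comment> \<open>K turns e^eps - 1 \<le> eps e^eps into a bound linear in eps on the whole range
    up to \<open>\<epsilon>max\<close>.\<close>
  define K where "K = exp \<epsilon>max"
  \<comment> \<open>The 40 makes the final upper bound 4 C (K + \<open>\<epsilon>max\<close>) N
    equal to N/10, safely below 23/100 N.\<close>
  define C where "C = 1 / (40 * (K + \<epsilon>max))"
  have K: "0 < K" by (simp add: K_def)
  have C: "0 < C" "C * (K + \<epsilon>max) = 1 / 40" using K assms by (auto simp: C_def)
  have main: "real n \<ge> C * sqrt (real (binom_le d k)) / (\<alpha> * \<epsilon>)"
    if k: "1 < k" "k \<le> d" and \<alpha>: "0 < \<alpha>" "\<alpha> < 1 / 2" and \<epsilon>: "0 < \<epsilon>" "\<epsilon> \<le> \<epsilon>max" and \<delta>: "0 \<le> \<delta>" "\<delta> \<le> 1"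
      and prot: "shuffle_protocol (sign_cube d) Y (query_space d) \<P>"
        "robustly_shuffle_private (sign_cube d) Y \<epsilon> \<delta> (1 / 3) \<P>"
        "releases_parities d k \<alpha> n (run_protocol Y \<P> n)"
      and small: "\<delta> * ln (real (binom_le d k) / \<delta>) \<le> 1 * \<alpha>\<^sup>2 * \<epsilon>\<^sup>2 / real (binom_le d k)"
    for d k n :: nat and \<alpha> \<epsilon> \<delta> :: real and Y :: "real measure"
      and \<P> :: "(real, nat \<Rightarrow> real, real, nat set \<Rightarrow> real) protocol"
  proof (rule ccontr)
    define N where "N = real (binom_le d k)"
    define r where "r = sqrt N"
    assume "\<not> real n \<ge> C * sqrt (real (binom_le d k)) / (\<alpha> * \<epsilon>)"
    then have n: "real n * \<alpha> * \<epsilon> \<le> C * r"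
      using \<alpha> \<epsilon> by (simp add: field_simps N_def r_def)
    have N3: "3 \<le> N" using binom_le_ge_3[OF k] by (simp add: N_def)
    have r: "1 \<le> r" "r * r = N" using N3 by (auto simp: r_def)
    \<comment> \<open>Since \<delta> \<le> 1 and N \<ge> 3 > e, the logarithm is at least 1; for
      \<delta> = 0 both sides vanish. With c = 1 the smallness condition thus yields \<delta> N
      \<le> \<alpha>^2 \<epsilon>^2.\<close>
    have "\<delta> \<le> \<delta> * ln (N / \<delta>)"
    proof (cases "\<delta> = 0")
      case False
      have "exp 1 \<le> N" using exp_le N3 by linarith
      also have "N \<le> N / \<delta>" using False \<delta> N3 by (simp add: le_divide_eq mult_left_le)
      finally have "ln (exp 1) \<le> ln (N / \<delta>)" by (rule ln_mono[rotated 2]) (use False \<delta> N3 in auto)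
      then show ?thesis using \<delta> by (simp add: mult_le_cancel_left1)
    qed simp
    also have "\<dots> \<le> \<alpha>\<^sup>2 * \<epsilon>\<^sup>2 / N" using small by (simp add: N_def)
    finally have "\<delta> * N \<le> \<alpha>\<^sup>2 * \<epsilon>\<^sup>2" using N3 by (simp add: field_simps)
    also have "\<dots> \<le> (1 / 2)\<^sup>2 * \<epsilon>\<^sup>2"
      using \<alpha> by (intro mult_right_mono power_mono) auto
    \<comment> \<open>One factor \<epsilon> is kept so that the \<delta> term is linear in
      \<epsilon>, like the bound on e^eps - 1.\<close>
    also have "\<dots> \<le> \<epsilon> * \<epsilon>max / 4" using \<epsilon> by (simp add: power2_eq_square)
    finally have \<delta>N: "\<delta> * N \<le> \<epsilon> * \<epsilon>max / 4" .
    have e: "exp \<epsilon> - 1 \<le> \<epsilon> * K"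
    proof -
      have "exp \<epsilon> - 1 \<le> \<epsilon> * exp \<epsilon>" by (rule exp_minus_one_le)
      also have "\<dots> \<le> \<epsilon> * K" unfolding K_def using \<epsilon> by (intro mult_left_mono) auto
      finally show ?thesis .
    qed
    have "23 / 100 * N \<le> real n * (4 * \<alpha>) * (r * (exp \<epsilon> - 1) + 2 * \<delta> * N)"
      unfolding N_def r_def by (rule parities_sample_inequality[OF \<alpha> \<epsilon>(1) \<delta>(1) prot])
    also have "\<dots> \<le> real n * (4 * \<alpha>) * (r * (\<epsilon> * K) + r * (\<epsilon> * \<epsilon>max))"
    proof (intro mult_left_mono add_mono)
      have "0 < \<epsilon> * \<epsilon>max" using \<epsilon> assms by simp
      with \<delta>N have "2 * \<delta> * N \<le> 1 * (\<epsilon> * \<epsilon>max)" by linarith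
      \<comment> \<open>The spare factor r \<ge> 1 gives the \<delta> term the same order as the
        main term, so that both combine into K + \<open>\<epsilon>max\<close>.\<close>
      also have "\<dots> \<le> r * (\<epsilon> * \<epsilon>max)" using r \<epsilon> assms by (intro mult_right_mono) auto
      finally show "2 * \<delta> * N \<le> r * (\<epsilon> * \<epsilon>max)" .
    qed (use e r \<alpha> in auto)
    also have "\<dots> = 4 * (real n * \<alpha> * \<epsilon>) * (r * (K + \<epsilon>max))" by (simp add: algebra_simps)
    also have "\<dots> \<le> 4 * (C * r) * (r * (K + \<epsilon>max))"
      using n r K assms by (intro mult_right_mono mult_left_mono) auto
    also have "\<dots> = 4 * (C * (K + \<epsilon>max)) * (r * r)" by (simp only: mult_ac)
    also have "\<dots> = N / 10" unfolding C(2) r(2) by simp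
    finally show False using N3 by simp
  qed
  show ?thesis
    by (rule exI[of _ 1], rule conjI[OF zero_less_one], rule exI[of _ C], rule conjI[OF C(1)])
       (use main in blast)
qed

end
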